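(* The set $\mathcal{S}=\{q^{-\frac12ab}X_m^aX_{m+1}^b\mid m\in\mathbb{Z},(a,b)\in\mathbb{Z}_{\ge0}^2\}\cup\{S_n(X_\delta)\mid n\ge1\}$ is the triangular basis of $\mathcal{A}_q(1,4)$, i.e. $\mathcal{S}=\{C_{(a,b)}\mid (a,b)\in\mathbb{Z}^2\}$.
   Context: Let $q^{1/2}$ be a formal variable and let $\mathcal{T}$ be the quantum torus over $\mathbb{Z}[q^{\pm\frac12}]$ generated by $X_1^{\pm1},X_2^{\pm1}$ with $X_1X_2=qX_2X_1$, with skew field of fractions $\mathcal{F}$. Define $X_k\in\mathcal{F}$ ($k\in\mathbb{Z}$) by $X_{k-1}X_{k+1}=q^{\frac12}X_k+1$ for $k$ odd and $X_{k-1}X_{k+1}=q^2X_k^4+1$ for $k$ even; $\mathcal{A}_q(1,4)$ is the $\mathbb{Z}[q^{\pm\frac12}]$-subalgebra of $\mathcal{F}$ generated by all $X_k$ (it lies in $\mathcal{T}$). Put $X^{(a,b)}=q^{-\frac12ab}X_1^aX_2^b$. The bar-involution is the $\mathbb{Z}$-linear map on $\mathcal{T}$ with $\overline{q^{r/2}X^{(a,b)}}=q^{-r/2}X^{(a,b)}$. Let $X_\delta=X^{(-1,-2)}+X^{(-1,2)}+X^{(1,-2)}+(q^{-\frac12}+q^{\frac12})X^{(0,-2)}$, and let $S_n$ be the Chebyshev polynomials $S_0=1$, $S_1=x$, $S_2=x^2-1$, $S_{n+1}=S_nx-S_{n-1}$ ($n\ge2$). For $x\in\mathbb{Z}$, $[x]_+=\max(x,0)$.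 The standard monomials are $E_{(a,b)}=q^{-\frac12ab}X_3^{[-a]_+}X_1^{[a]_+}X_2^{[b]_+}X_0^{[-b]_+}$ for $(a,b)\in\mathbb{Z}^2$; they form a $\mathbb{Z}[q^{\pm\frac12}]$-basis of $\mathcal{A}_q(1,4)$. Let $\mathcal{A}_+=\bigoplus_{(a,b)}\mathbb{Z}[q^{-\frac12}]E_{(a,b)}$. For each $(a,b)\in\mathbb{Z}^2$ there is a unique element $C_{(a,b)}\in\mathcal{A}_q(1,4)$ with $\overline{C_{(a,b)}}=C_{(a,b)}$ and $C_{(a,b)}-E_{(a,b)}\in q^{-\frac12}\mathcal{A}_+$ (Berenstein–Zelevinsky); the set $\{C_{(a,b)}\}$ is the (canonical) triangular basis. *)

theory Defs
  imports Main "HOL-Library.Poly_Mapping"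
begin

text \<open>An element of the quantum torus is a finitely supported integer combination of
  monomials v^r X^(a,b) (v = q^(1/2), X^(a,b) = q^(-ab/2) X1^a X2^b); the key (r,a,b)
  stands for the monomial v^r X^(a,b).\<close>

type_synonym qt = "(int \<times> int \<times> int) \<Rightarrow>\<^sub>0 int"

text \<open>X^e X^f = q^(Lambda(e,f)/2) X^(e+f) with Lambda(e,f) = e1 f2 - e2 f1
  (this encodes X1 X2 = q X2 X1).\<close>
fun key_mul :: "int \<times> int \<times> int \<Rightarrow> int \<times> int \<times> int \<Rightarrow> int \<times> int \<times> int" where
  "key_mul (r, a, b) (s, c, d) = (r + s + (a * d - b * c), a + c, b + d)"

definition qmul :: "qt \<Rightarrow> qt \<Rightarrow> qt" (infixl "\<star>" 70) where
  "f \<star> g = (\<Sum>k\<in>Poly_Mapping.keys f. \<Sum>l\<in>Poly_Mapping.keys g.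
              Poly_Mapping.single (key_mul k l) (Poly_Mapping.lookup f k * Poly_Mapping.lookup g l))"

definition qmon :: "int \<Rightarrow> int \<Rightarrow> int \<Rightarrow> qt" where
  "qmon r a b = Poly_Mapping.single (r, a, b) 1"

definition qone :: qt where "qone = qmon 0 0 0"

primrec qpow :: "qt \<Rightarrow> nat \<Rightarrow> qt" where
  "qpow f 0 = qone"
| "qpow f (Suc n) = qpow f n \<star> f"

fun bar_key :: "int \<times> int \<times> int \<Rightarrow> int \<times> int \<times> int" where
  "bar_key (r, a, b) = (- r, a, b)"

definition qbar :: "qt \<Rightarrow> qt" where
  "qbar f = (\<Sum>k\<in>Poly_Mapping.keys f. Poly_Mapping.single (bar_key k) (Poly_Mapping.lookup f k))"

definition qX1 :: qt where "qX1 = qmon 0 1 0"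
definition qX2 :: qt where "qX2 = qmon 0 0 1"

text \<open>The cluster variables X_k (k in Z): the (unique, since T is a domain) sequence in T
  with X_1, X_2 the generators and the exchange relations
  X_(k-1) X_(k+1) = q^(1/2) X_k + 1 (k odd), X_(k-1) X_(k+1) = q^2 X_k^4 + 1 (k even).\<close>
definition clusterX :: "int \<Rightarrow> qt" where
  "clusterX = (THE X. X 1 = qX1 \<and> X 2 = qX2
      \<and> (\<forall>k. odd k \<longrightarrow> X (k - 1) \<star> X (k + 1) = qmon 1 0 0 \<star> X k + qone)
      \<and> (\<forall>k. even k \<longrightarrow> X (k - 1) \<star> X (k + 1) = qmon 4 0 0 \<star> qpow (X k) 4 + qone))"

inductive_set Aq14 :: "qt set" where
  gen: "clusterX k \<in> Aq14"
| scal: "qmon r 0 0 \<in> Aq14"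
| add: "f \<in> Aq14 \<Longrightarrow> g \<in> Aq14 \<Longrightarrow> f + g \<in> Aq14"
| neg: "f \<in> Aq14 \<Longrightarrow> - f \<in> Aq14"
| mul: "f \<in> Aq14 \<Longrightarrow> g \<in> Aq14 \<Longrightarrow> f \<star> g \<in> Aq14"

definition pos_part :: "int \<Rightarrow> int" where "pos_part x = max x 0"

definition stdmon :: "int \<Rightarrow> int \<Rightarrow> qt" where
  "stdmon a b = qmon (- (a * b)) 0 0 \<star> qpow (clusterX 3) (nat (pos_part (- a)))
     \<star> qpow (clusterX 1) (nat (pos_part a)) \<star> qpow (clusterX 2) (nat (pos_part b))
     \<star> qpow (clusterX 0) (nat (pos_part (- b)))"

definition neg_scalars :: "qt set" where
  "neg_scalars = {c. \<forall>(r, a, b) \<in> Poly_Mapping.keys c. r < 0 \<and> a = 0 \<and> b = 0}"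

text \<open>q^(-1/2) A_+ where A_+ = direct sum of Z[q^(-1/2)] E_(a,b).\<close>
definition qinv_Aplus :: "qt set" where
  "qinv_Aplus = {y. \<exists>F c. finite F \<and> (\<forall>p\<in>F. c p \<in> neg_scalars)
                      \<and> y = (\<Sum>p\<in>F. c p \<star> stdmon (fst p) (snd p))}"

definition triangC :: "int \<Rightarrow> int \<Rightarrow> qt" where
  "triangC a b = (THE c. c \<in> Aq14 \<and> qbar c = c \<and> c - stdmon a b \<in> qinv_Aplus)"

definition Xdelta :: qt where
  "Xdelta = qmon 0 (-1) (-2) + qmon 0 (-1) 2 + qmon 0 1 (-2)
            + (qmon (-1) 0 0 + qmon 1 0 0) \<star> qmon 0 0 (-2)"

fun cheb :: "nat \<Rightarrow> qt \<Rightarrow> qt" where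
  "cheb 0 x = qone"
| "cheb (Suc 0) x = x"
| "cheb (Suc (Suc n)) x = cheb (Suc n) x \<star> x - cheb n x"

end

theory Submission
  imports Defs
begin

text \<open>Write v for the square root of q, P for the Z[v^-1]-module spanned by the v^-1 E_(a,b), and
  E^m_(a,b) for the standard monomials of the seed (X_m, X_(m+1)), so that E^1 = E.

  Each E_(a,b) is pointed at (a,b): its lexicographically lowest term is X^(a,b). Hence P contains
  no nonzero bar-invariant element, and C_(a,b) is the only bar-invariant element congruent to
  E_(a,b) modulo P.

  A word X_3^a X_1^c X_2^d X_0^b, scaled by a suitable power of v, is congruent to
  E_(c-a,d-b) modulo P, because both exchange relations produce their second term with a negative
  power of v. Writing X_4 through X_0, ..., X_3 and straightening gives, for every m,
  that E^(m+1)_(c,d) is congruent to E^m_(-d-e[-c]+,c) modulo P, where e is the exponent in the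
  exchange relation at m. So all seeds define the same triangular basis and every cluster monomial,
  being a bar-invariant E^m_(a,b) with a, b nonnegative, belongs to it.

  The Chebyshev polynomials are reached through the products
  v^-n X_(2n+2) X_0 = S_n + v^-2 S_(n-2) + v^-4 v^-(n-2) X_(2n) X_2, the first of which is
  congruent to E_(-n,-2n). Finally the tropical maps on exponents move every (a,b) not on the ray
  through (-1,-2) into the cone of some cluster, which shows that nothing is missing.\<close>

section \<open>The quantum torus as a ring\<close>

text \<open>P is a module over polynomials in v^-1 but not an ideal, so a congruence modulo P cannot
  simply be multiplied by a cluster variable; every rearrangement has to account for its exact power
  of v. Two facts keep the errors inside P. Rewriting A^n B^n by A B = v^-g C^g + 1 gives powers of
  C whose coefficients contain no positive power of v, and only negative powers from index 1 on.
  Right multiplication by v^-n X_0 takes E_(a,b) to v^(-n-a) times an element congruent to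
  E_(a,b-1), so it is harmless where a >= -n; for the error of X_(2n+2) this bound is read off the
  X_1-exponents that occur in it. The product formula for S_n has a linear origin: X_delta times
  X_(2j) is a combination of the two even neighbours, so left multiplication by X_delta acts on v^-n
  X_(2n+2) X_0 as the Chebyshev recursion in n. The same relation builds the cluster variables. As
  \<open>clusterX\<close> is a definite description, a solution of the exchange relations in the
  torus has to be exhibited and shown unique before anything else can be said about it.\<close>

lemma frag_cmul_single: "frag_cmul c (Poly_Mapping.single k d) = Poly_Mapping.single k (c * d)"
  by (rule poly_mapping_eqI) (simp add: lookup_single when_def)

text \<open>In this form the product is visibly the biadditive extension of \<open>key_mul\<close>,
  so ring laws can be checked on keys by \<open>frag_induction\<close>.\<close>

lemma qmul_extend: "f \<star> g = frag_extend (\<lambda>k. frag_extend (\<lambda>l. frag_of (key_mul k l)) g) f"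
  unfolding qmul_def frag_extend_def by (simp add: frag_cmul_sum frag_cmul_single)

lemma qmul_diff_left: "(f - g) \<star> h = f \<star> h - g \<star> h"
  by (simp add: qmul_extend frag_extend_diff)

lemma qmul_add_left: "(f + g) \<star> h = f \<star> h + g \<star> h"
  by (simp add: qmul_extend frag_extend_add)

lemma qmul_zero: "0 \<star> h = 0" "h \<star> 0 = 0"
  by (simp_all add: qmul_def)

lemma qmul_of: "frag_of k \<star> frag_of l = frag_of (key_mul k l)"
  by (simp add: qmul_extend)

lemma qmul_diff_right: "h \<star> (f - g) = h \<star> f - h \<star> g"
  using subset_UNIV[of "Poly_Mapping.keys h"]
  by (induction h rule: frag_induction)
     (simp_all add: qmul_zero qmul_diff_left, simp add: qmul_extend frag_extend_diff)

lemma qmul_add_right: "h \<star> (f + g) = h \<star> f + h \<star> g"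
  using qmul_diff_right[of h f "0 - g"] qmul_diff_right[of h 0 g] by (simp add: qmul_zero)

lemma key_mul_assoc: "key_mul (key_mul k l) m = key_mul k (key_mul l m)"
  by (cases k; cases l; cases m) (simp add: algebra_simps)

lemma qmul_assoc: "(f \<star> g) \<star> h = f \<star> (g \<star> h)"
proof -
  have 1: "(frag_of k \<star> frag_of l) \<star> h = frag_of k \<star> (frag_of l \<star> h)" for k l
    using subset_UNIV[of "Poly_Mapping.keys h"]
    by (induction h rule: frag_induction)
       (simp_all add: qmul_zero qmul_diff_right qmul_of key_mul_assoc)
  have 2: "(frag_of k \<star> g) \<star> h = frag_of k \<star> (g \<star> h)" for k
    using subset_UNIV[of "Poly_Mapping.keys g"]
    by (induction g rule: frag_induction)
       (simp_all add: qmul_zero qmul_diff_left qmul_diff_right 1)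
  show ?thesis
    using subset_UNIV[of "Poly_Mapping.keys f"]
    by (induction f rule: frag_induction) (simp_all add: qmul_zero qmul_diff_left 2)
qed

lemma qone_mul: "qone \<star> f = f" "f \<star> qone = f"
proof -
  have k: "key_mul (0,0,0) k = k" "key_mul k (0,0,0) = k" for k
    by (cases k; simp)+
  show "qone \<star> f = f" using subset_UNIV[of "Poly_Mapping.keys f"]
    by (induction f rule: frag_induction)
       (simp_all add: qone_def qmon_def qmul_zero qmul_diff_right qmul_of k)
  show "f \<star> qone = f" using subset_UNIV[of "Poly_Mapping.keys f"]
    by (induction f rule: frag_induction)
       (simp_all add: qone_def qmon_def qmul_zero qmul_diff_left qmul_of k)
qed

lemma keys_qmul:
  assumes "m \<in> Poly_Mapping.keys (f \<star> g)"
  obtains k l where "k \<in> Poly_Mapping.keys f" "l \<in> Poly_Mapping.keys g" "m = key_mul k l"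
proof -
  obtain k where k: "k \<in> Poly_Mapping.keys f"
      "m \<in> Poly_Mapping.keys (frag_extend (\<lambda>l. frag_of (key_mul k l)) g)"
    using subsetD[OF keys_frag_extend assms[unfolded qmul_extend]] by (rule UN_E)
  obtain l where l: "l \<in> Poly_Mapping.keys g" "m \<in> Poly_Mapping.keys (frag_of (key_mul k l))"
    using subsetD[OF keys_frag_extend k(2)] by (rule UN_E)
  show ?thesis using that[OF k(1) l(1)] l(2) by simp
qed

lemma lookup_qmul:
  "Poly_Mapping.lookup (f \<star> g) m = (\<Sum>k\<in>Poly_Mapping.keys f. \<Sum>l\<in>Poly_Mapping.keys g.
     if key_mul k l = m then Poly_Mapping.lookup f k * Poly_Mapping.lookup g l else 0)"
  by (simp add: qmul_def lookup_sum lookup_single when_def)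

text \<open>Keys are ordered lexicographically by exponent first and by the power of v last; this
  order is compatible with multiplication of keys although that is not commutative.\<close>

definition key_less :: "int \<times> int \<times> int \<Rightarrow> int \<times> int \<times> int \<Rightarrow> bool" where
  "key_less k l = (case (k, l) of ((r, a, b), (s, c, d)) \<Rightarrow>
     a < c \<or> a = c \<and> (b < d \<or> b = d \<and> r < s))"

lemma key_less_linear: "key_less k l \<or> k = l \<or> key_less l k"
  by (cases k; cases l) (auto simp: key_less_def)

lemma key_less_trans: "key_less k l \<Longrightarrow> key_less l m \<Longrightarrow> key_less k m"
  by (cases k; cases l; cases m) (auto simp: key_less_def)

lemma key_less_irrefl: "\<not> key_less k k"
  by (cases k) (auto simp: key_less_def)

lemma key_mul_strict:
  "key_less k k' \<Longrightarrow> key_less (key_mul k l) (key_mul k' l)"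
  "key_less l l' \<Longrightarrow> key_less (key_mul k l) (key_mul k l')"
  by (cases k; cases l; cases k'; auto simp: key_less_def)
     (cases k; cases l; cases l'; auto simp: key_less_def)

lemma key_max_exists:
  assumes "finite K" "K \<noteq> {}"
  shows "\<exists>m\<in>K. \<forall>k\<in>K. k \<noteq> m \<longrightarrow> key_less k m"
  using assms
proof (induction K rule: finite_ne_induct)
  case (insert x K)
  then obtain m where m: "m \<in> K" "\<forall>k\<in>K. k \<noteq> m \<longrightarrow> key_less k m" by blast
  show ?case
  proof (cases "key_less m x")
    case True
    then have "\<forall>k\<in>insert x K. k \<noteq> x \<longrightarrow> key_less k x"
      using m True key_less_trans[OF _ True] by (metis insertE)
    then show ?thesis by blast
  next
    case False
    then have "\<forall>k\<in>insert x K. k \<noteq> m \<longrightarrow> key_less k m"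
      using m key_less_linear[of x m] by (metis insertE)
    then show ?thesis using m by blast
  qed
qed simp

text \<open>Since \<open>key_mul\<close> is strictly monotone in both arguments, the product of the
  two largest keys arises from one pair only, and its coefficient is a product of nonzero
  integers.\<close>

lemma qmul_nonzero:
  assumes "f \<noteq> 0" "g \<noteq> 0"
  shows "f \<star> g \<noteq> 0"
proof -
  obtain k where k: "k \<in> Poly_Mapping.keys f" "\<forall>x\<in>Poly_Mapping.keys f. x \<noteq> k \<longrightarrow> key_less x k"
    using key_max_exists[of "Poly_Mapping.keys f"] assms by auto
  obtain l where l: "l \<in> Poly_Mapping.keys g" "\<forall>x\<in>Poly_Mapping.keys g. x \<noteq> l \<longrightarrow> key_less x l"
    using key_max_exists[of "Poly_Mapping.keys g"] assms by auto
  have top: "key_mul x y = key_mul k l \<longleftrightarrow> x = k \<and> y = l"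
    if "x \<in> Poly_Mapping.keys f" "y \<in> Poly_Mapping.keys g" for x y
  proof -
    have "x = k \<or> key_less x k" "y = l \<or> key_less y l"
      using that k l by blast+
    then have "key_less (key_mul x y) (key_mul k l)" if "\<not> (x = k \<and> y = l)"
      using that key_mul_strict(1)[of x k y] key_mul_strict(2)[of y l k]
        key_less_trans[of "key_mul x y" "key_mul k y" "key_mul k l"] by auto
    then show ?thesis using key_less_irrefl by metis
  qed
  have "Poly_Mapping.lookup (f \<star> g) (key_mul k l) =
     (\<Sum>x\<in>Poly_Mapping.keys f. \<Sum>y\<in>Poly_Mapping.keys g. if x = k \<and> y = l
        then Poly_Mapping.lookup f k * Poly_Mapping.lookup g l else 0)"
    unfolding lookup_qmul by (intro sum.cong refl) (auto simp: top)
  also have "\<dots> = (\<Sum>x\<in>Poly_Mapping.keys f. if x = k then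
       (\<Sum>y\<in>Poly_Mapping.keys g. if y = l then Poly_Mapping.lookup f k * Poly_Mapping.lookup g l
          else 0) else 0)"
    by (intro sum.cong refl) auto
  also have "\<dots> = Poly_Mapping.lookup f k * Poly_Mapping.lookup g l"
    using k l by simp
  finally have "Poly_Mapping.lookup (f \<star> g) (key_mul k l) \<noteq> 0"
    using k l by (simp add: in_keys_iff)
  then show ?thesis by auto
qed

text \<open>Finitely supported maps already carry an untwisted convolution product; a copy of the
  type lets the twisted product be the ring multiplication.\<close>

typedef qtorus = "UNIV :: qt set" morphisms rep tor by simp

setup_lifting type_definition_qtorus

instantiation qtorus :: ring_1_no_zero_divisors
begin
lift_definition zero_qtorus :: qtorus is 0 .
lift_definition one_qtorus :: qtorus is qone .
lift_definition plus_qtorus :: "qtorus \<Rightarrow> qtorus \<Rightarrow> qtorus" is "(+)" .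
lift_definition minus_qtorus :: "qtorus \<Rightarrow> qtorus \<Rightarrow> qtorus" is "(-)" .
lift_definition uminus_qtorus :: "qtorus \<Rightarrow> qtorus" is "uminus" .
lift_definition times_qtorus :: "qtorus \<Rightarrow> qtorus \<Rightarrow> qtorus" is qmul .
instance
proof
  fix a b c :: qtorus
  show "a * b * c = a * (b * c)" by transfer (rule qmul_assoc)
  show "1 * a = a" by transfer (rule qone_mul)
  show "a * 1 = a" by transfer (rule qone_mul)
  show "a + b + c = a + (b + c)" by transfer (rule add.assoc)
  show "a + b = b + a" by transfer (rule add.commute)
  show "0 + a = a" by transfer (rule add_0)
  show "- a + a = 0" by transfer (rule left_minus)
  show "a - b = a + - b" by transfer (rule diff_conv_add_uminus)
  show "0 * a = 0" by transfer (rule qmul_zero)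
  show "a * 0 = 0" by transfer (rule qmul_zero)
  show "(a + b) * c = a * c + b * c" by transfer (rule qmul_add_left)
  show "a * (b + c) = a * b + a * c" by transfer (rule qmul_add_right)
  show "(0::qtorus) \<noteq> 1" by transfer (metis qone_def qmon_def frag_of_nonzero)
  show "a \<noteq> 0 \<Longrightarrow> b \<noteq> 0 \<Longrightarrow> a * b \<noteq> 0" by transfer (rule qmul_nonzero)
qed
end

lemma tor_simps:
  "tor 0 = 0" "tor qone = 1" "tor (f + g) = tor f + tor g" "tor (f - g) = tor f - tor g"
  "tor (- f) = - tor f" "tor (f \<star> g) = tor f * tor g"
  by (simp_all add: zero_qtorus_def one_qtorus_def plus_qtorus.abs_eq minus_qtorus.abs_eq
      uminus_qtorus.abs_eq times_qtorus.abs_eq)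

lemma tor_pow: "tor (qpow f n) = tor f ^ n"
  by (induction n) (simp_all add: tor_simps power_Suc2 del: power_Suc)

lemma tor_eq_iff: "tor f = tor g \<longleftrightarrow> f = g"
  by (simp add: tor_inject)

lemma tor_sum: "tor (sum f I) = (\<Sum>i\<in>I. tor (f i))"
  by (induction I rule: infinite_finite_induct) (simp_all add: tor_simps)

definition mon :: "int \<Rightarrow> int \<Rightarrow> int \<Rightarrow> qtorus" where
  "mon r a b = tor (qmon r a b)"

abbreviation vp :: "int \<Rightarrow> qtorus" where "vp r \<equiv> mon r 0 0"

lemma mon_mult: "mon r a b * mon s c d = mon (r + s + (a * d - b * c)) (a + c) (b + d)"
  by (simp add: mon_def qmon_def tor_simps(6)[symmetric] qmul_of)

lemma mon_0: "mon 0 0 0 = 1"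
  by (simp add: mon_def one_qtorus_def qone_def)

lemma mon_eq_iff: "mon r a b = mon s c d \<longleftrightarrow> r = s \<and> a = c \<and> b = d"
  by (auto simp: mon_def tor_eq_iff qmon_def frag_of_eq)

lemma mon_nonzero: "mon r a b \<noteq> 0"
  unfolding mon_def tor_simps(1)[symmetric] tor_eq_iff by (simp add: qmon_def)

lemma qtorus_induct [case_names zero mon diff]:
  assumes "P 0" "\<And>r a b. P (mon r a b)" "\<And>x y. P x \<Longrightarrow> P y \<Longrightarrow> P (x - y)"
  shows "P x"
proof -
  have "P (tor f)" for f
    using subset_UNIV[of "Poly_Mapping.keys f"]
  proof (induction f rule: frag_induction)
    case (one k) then show ?case using assms(2) by (cases k) (simp add: mon_def qmon_def)
  qed (use assms in \<open>auto simp: tor_simps\<close>)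
  then show ?thesis using tor_cases[of x] by auto
qed

lemma vp_central: "x * vp r = vp r * x"
  by (induction x rule: qtorus_induct) (simp_all add: algebra_simps mon_mult)

lemma vp_add: "vp (r + s) = vp r * vp s"
  by (simp add: mon_mult)

section \<open>Anti-automorphisms of the torus\<close>

definition key_map :: "(int \<times> int \<times> int \<Rightarrow> int \<times> int \<times> int) \<Rightarrow> qtorus \<Rightarrow> qtorus" where
  "key_map h x = tor (frag_extend (\<lambda>k. frag_of (h k)) (rep x))"

lemma key_map_diff: "key_map h (x - y) = key_map h x - key_map h y"
  by (simp add: key_map_def minus_qtorus.rep_eq frag_extend_diff tor_simps)

lemma key_map_add: "key_map h (x + y) = key_map h x + key_map h y"
  by (simp add: key_map_def plus_qtorus.rep_eq frag_extend_add tor_simps)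

lemma key_map_zero: "key_map h 0 = 0"
  by (simp add: key_map_def zero_qtorus.rep_eq tor_simps)

lemma key_map_mon: "h (r, a, b) = (s, c, d) \<Longrightarrow> key_map h (mon r a b) = mon s c d"
  by (simp add: key_map_def mon_def tor_inverse qmon_def)

lemma key_map_antimult:
  assumes "\<And>k l. h (key_mul k l) = key_mul (h l) (h k)"
  shows "key_map h (x * y) = key_map h y * key_map h x"
proof -
  have "key_map h (mon r a b * y) = key_map h y * key_map h (mon r a b)" for r a b
  proof (induction y rule: qtorus_induct)
    case (mon s c d)
    obtain r' a' b' s' c' d' where h: "h (r, a, b) = (r', a', b')" "h (s, c, d) = (s', c', d')"
      by (metis surj_pair)
    have "h (key_mul (r, a, b) (s, c, d)) = key_mul (s', c', d') (r', a', b')"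
      unfolding assms h ..
    then show ?case
      unfolding mon_mult by (subst key_map_mon, force) (simp add: key_map_mon[of h, OF h(1)] key_map_mon[of h, OF h(2)] mon_mult)
  qed (simp_all add: key_map_zero key_map_diff algebra_simps)
  then show ?thesis
    by (induction x rule: qtorus_induct) (simp_all add: key_map_zero key_map_diff algebra_simps)
qed

definition bar :: "qtorus \<Rightarrow> qtorus" where "bar = key_map bar_key"

text \<open>An anti-automorphism fixing v; it exchanges the two directions of mutation.\<close>

definition flip :: "qtorus \<Rightarrow> qtorus" where "flip = key_map (\<lambda>(r, a, b). (r, b, a))"

lemma bar_simps:
  "bar 0 = 0" "bar (x + y) = bar x + bar y" "bar (x - y) = bar x - bar y"
  "bar (mon r a b) = mon (- r) a b" "bar (x * y) = bar y * bar x" "bar 1 = 1"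
proof -
  have "bar_key (key_mul k l) = key_mul (bar_key l) (bar_key k)" for k l
    by (cases k; cases l) (simp add: algebra_simps)
  then show "bar (x * y) = bar y * bar x" unfolding bar_def by (rule key_map_antimult)
  show "bar (mon r a b) = mon (- r) a b" by (simp add: bar_def key_map_mon)
  show "bar 1 = 1" unfolding mon_0[symmetric] by (simp add: bar_def key_map_mon)
qed (simp_all add: bar_def key_map_zero key_map_add key_map_diff)

lemma flip_simps:
  "flip 0 = 0" "flip (x + y) = flip x + flip y" "flip (x - y) = flip x - flip y"
  "flip (mon r a b) = mon r b a" "flip (x * y) = flip y * flip x" "flip 1 = 1"
proof -
  let ?h = "\<lambda>(r, a, b). (r :: int, b :: int, a :: int)"
  have "?h (key_mul k l) = key_mul (?h l) (?h k)" for k l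
    by (cases k; cases l) (simp add: algebra_simps)
  then show "flip (x * y) = flip y * flip x" unfolding flip_def by (rule key_map_antimult)
  show "flip (mon r a b) = mon r b a" by (simp add: flip_def key_map_mon)
  show "flip 1 = 1" unfolding mon_0[symmetric] by (simp add: flip_def key_map_mon)
qed (simp_all add: flip_def key_map_zero key_map_add key_map_diff)

lemma bar_pow: "bar (x ^ n) = bar x ^ n"
  by (induction n) (simp_all add: bar_simps power_commutes)

lemma flip_pow: "flip (x ^ n) = flip x ^ n"
  by (induction n) (simp_all add: flip_simps power_commutes)

lemma flip_flip: "flip (flip x) = x"
  by (induction x rule: qtorus_induct) (simp_all add: flip_simps)

lemma tor_qbar: "tor (qbar f) = bar (tor f)"
  by (simp add: bar_def key_map_def qbar_def frag_extend_def frag_cmul_single tor_inverse)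

section \<open>Straightening of words and change of seed\<close>

locale central_powers =
  fixes q :: "int \<Rightarrow> 'a :: ring_1_no_zero_divisors"
  assumes q_0 [simp]: "q 0 = 1"
    and q_add: "q (i + j) = q i * q j"
    and q_central: "x * q i = q i * x"
begin

lemma q_merge: "q i * (q j * x) = q (i + j) * x"
  by (simp add: q_add mult.assoc)

lemma q_left: "y * (q i * x) = q i * (y * x)"
  by (simp add: q_central flip: mult.assoc)

lemma q_left_pow: "y ^ m * (q i * x) = q i * (y ^ m * x)"
  by (rule q_left)

lemma power_qcommute:
  assumes "a * b = q k * (b * a)"
  shows "a ^ m * b ^ n = q (k * int m * int n) * (b ^ n * a ^ m)"
proof -
  have 1: "a * b ^ n = q (k * int n) * (b ^ n * a)"
  proof (induction n)
    case (Suc n)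
    have "a * b ^ Suc n = (a * b) * b ^ n" by (simp add: mult.assoc)
    also have "\<dots> = q k * (b * (a * b ^ n))" by (simp add: assms mult.assoc)
    also have "\<dots> = q (k * int (Suc n)) * (b ^ Suc n * a)"
      by (simp add: Suc q_left[of b] q_merge mult.assoc algebra_simps)
    finally show ?case .
  qed simp
  show ?thesis
  proof (induction m)
    case (Suc m)
    have "a ^ Suc m * b ^ n = a * (a ^ m * b ^ n)" by (simp add: mult.assoc)
    also have "\<dots> = q (k * int m * int n) * ((a * b ^ n) * a ^ m)"
      by (simp add: Suc q_left[of a] mult.assoc)
    also have "\<dots> = q (k * int (Suc m) * int n) * (b ^ n * a ^ Suc m)"
      by (simp add: 1 q_merge mult.assoc algebra_simps)
    finally show ?case .
  qed simp
qed

lemma power_qcommute':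
  assumes "a * b = q k * (b * a)"
  shows "a ^ m * (b ^ n * x) = q (k * int m * int n) * (b ^ n * (a ^ m * x))"
  by (simp add: power_qcommute[OF assms] flip: mult.assoc)

lemma qcommute_sym:
  assumes "a * b = q k * (b * a)"
  shows "b * a = q (- k) * (a * b)"
  by (simp add: assms q_merge)

text \<open>Gaussian binomials, written so that the coefficient of index i lies in
  q to the power -g i^2 times polynomials in q^-1.\<close>

primrec gbin :: "nat \<Rightarrow> nat \<Rightarrow> nat \<Rightarrow> 'a" where
  "gbin g 0 i = (if i = 0 then 1 else 0)"
| "gbin g (Suc n) i = gbin g n i
     + (if i = 0 then 0 else q (- int (g * (2 * n + 1))) * gbin g n (i - 1))"

lemma gbin_eq_0: "n < i \<Longrightarrow> gbin g n i = 0"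
  by (induction n arbitrary: i) auto

lemma gbin_0 [simp]: "gbin g n 0 = 1"
  by (induction n) auto

lemma gbin_central: "x * gbin g n i = gbin g n i * x"
proof (induction n arbitrary: i)
  case (Suc n)
  have "x * (q k * gbin g n (i - 1)) = q k * gbin g n (i - 1) * x" for k
    by (simp add: q_left[of x] Suc mult.assoc)
  then show ?case by (simp add: distrib_left distrib_right Suc)
qed simp

lemma gbin_left: "y * (gbin g n i * x) = gbin g n i * (y * x)"
  by (simp add: gbin_central flip: mult.assoc)

text \<open>Peeling off the innermost \<open>A * B\<close> and carrying \<open>C ^ g\<close> to the
  right over \<open>B ^ n\<close> costs v^(-2gn), so step n multiplies by 1 + v^(-g(2n+1))
  \<open>C ^ g\<close>; \<open>gbin\<close> collects the coefficients of the product of these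
  factors.\<close>

lemma power_mult_power_gbin:
  assumes AB: "A * B = q (- int g) * C ^ g + 1" and CB: "C * B = q (- 2) * (B * C)"
  shows "A ^ n * B ^ n = (\<Sum>i\<le>n. gbin g n i * C ^ (g * i))"
proof (induction n)
  case (Suc n)
  have "A ^ Suc n * B ^ Suc n = A ^ n * (A * B) * B ^ n"
    by (simp add: power_Suc2[of A] mult.assoc del: power_Suc) (simp add: mult.assoc)
  also have "\<dots> = A ^ n * B ^ n + q (- int g) * (A ^ n * (C ^ g * B ^ n))"
    by (simp add: AB distrib_left distrib_right q_left_pow mult.assoc)
  also have "\<dots> = A ^ n * B ^ n + q (- int (g * (2 * n + 1))) * (A ^ n * B ^ n) * C ^ g"
    by (simp add: power_qcommute[OF CB] q_left_pow q_merge mult.assoc algebra_simps)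
  also have "\<dots> = (\<Sum>i\<le>n. gbin g n i * C ^ (g * i))
      + (\<Sum>i\<le>n. q (- int (g * (2 * n + 1))) * gbin g n i * C ^ (g * Suc i))"
    by (simp add: Suc sum_distrib_left sum_distrib_right mult.assoc power_add power_commutes
             flip: power_add) (simp add: add.commute)
  also have "(\<Sum>i\<le>n. q (- int (g * (2 * n + 1))) * gbin g n i * C ^ (g * Suc i))
      = (\<Sum>i\<le>Suc n. (if i = 0 then 0 else q (- int (g * (2 * n + 1))) * gbin g n (i - 1)) * C ^ (g * i))"
    by (subst sum.atMost_Suc_shift) simp
  also have "(\<Sum>i\<le>n. gbin g n i * C ^ (g * i)) = (\<Sum>i\<le>Suc n. gbin g n i * C ^ (g * i))"
    by (simp add: gbin_eq_0)
  also have "(\<Sum>i\<le>Suc n. gbin g n i * C ^ (g * i)) + (\<Sum>i\<le>Suc n. (if i = 0 then 0 else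
       q (- int (g * (2 * n + 1))) * gbin g n (i - 1)) * C ^ (g * i))
     = (\<Sum>i\<le>Suc n. gbin g (Suc n) i * C ^ (g * i))"
    by (subst sum.distrib[symmetric], rule sum.cong) (simp_all add: distrib_right)
  finally show ?case .
qed simp

end

text \<open>\<open>P\<close> stands for q^(-1/2) A_+. It stays abstract because the locale is used
  both for the actual module and for its preimage under \<open>flip\<close>.\<close>

locale qinv_module = central_powers q for q :: "int \<Rightarrow> 'a :: ring_1_no_zero_divisors" +
  fixes P :: "'a set"
  assumes P_0 [simp]: "0 \<in> P"
    and P_diff: "x \<in> P \<Longrightarrow> y \<in> P \<Longrightarrow> x - y \<in> P"
    and P_q: "x \<in> P \<Longrightarrow> k \<ge> 0 \<Longrightarrow> q (- k) * x \<in> P"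
begin

lemma P_uminus: "x \<in> P \<Longrightarrow> - x \<in> P"
  using P_diff[of 0 x] by simp

lemma P_add: "x \<in> P \<Longrightarrow> y \<in> P \<Longrightarrow> x + y \<in> P"
  using P_diff[of x "- y"] P_uminus by simp

lemma P_sum: "(\<And>i. i \<in> I \<Longrightarrow> f i \<in> P) \<Longrightarrow> sum f I \<in> P"
  by (induction I rule: infinite_finite_induct) (auto intro: P_add)

lemma P_cong_trans: "x - y \<in> P \<Longrightarrow> y - z \<in> P \<Longrightarrow> x - z \<in> P"
  using P_add[of "x - y" "y - z"] by simp

lemma P_cong_sym: "x - y \<in> P \<Longrightarrow> y - x \<in> P"
  using P_uminus[of "x - y"] by simp

text \<open>Membership in the lattice A_+, expressed through P = v^-1 A_+ alone.\<close>

definition lat :: "'a \<Rightarrow> bool" where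
  "lat x \<longleftrightarrow> (\<forall>k\<ge>1. q (- k) * x \<in> P)"

lemma latI: "q (- 1) * x \<in> P \<Longrightarrow> lat x"
  unfolding lat_def using P_q[of "q (- 1) * x" "k - 1" for k] by (simp add: q_merge)

lemma latD: "lat x \<Longrightarrow> k \<le> - 1 \<Longrightarrow> q k * x \<in> P"
  unfolding lat_def by (drule spec[of _ "- k"]) auto

lemma lat_cong: "x - y \<in> P \<Longrightarrow> lat y \<Longrightarrow> lat x"
  unfolding lat_def
proof safe
  fix k :: int assume "x - y \<in> P" "\<forall>k\<ge>1. q (- k) * y \<in> P" "1 \<le> k"
  then show "q (- k) * x \<in> P"
    using P_add[OF P_q[of "x - y" k], of "q (- k) * y"] by (simp add: right_diff_distrib)
qed

text \<open>\<open>gbin g n i\<close> is a sum of powers v^-j in which j is g times a sum of i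
  distinct odd numbers, hence at least g (1 + 3 + ... + (2i-1)) = g i^2.\<close>

lemma gbin_mem:
  assumes "\<And>j. j \<ge> int (g * i ^ 2) \<Longrightarrow> q (- j) * x \<in> P"
  shows "gbin g n i * x \<in> P"
  using assms
proof (induction n arbitrary: i x)
  case 0
  then show ?case using "0"[of 0] by (cases "i = 0") auto
next
  case (Suc n)
  have 1: "gbin g n i * x \<in> P" using Suc by blast
  show ?case
  proof (cases "i = 0 \<or> n < i - 1")
    case True
    then show ?thesis using 1 gbin_eq_0[of n "i - 1"] by auto
  next
    case False
    then obtain i' where i: "i = Suc i'" "i' \<le> n" by (cases i) auto
    have "gbin g n i' * (q (- int (g * (2 * n + 1))) * x) \<in> P"
    proof (rule Suc.IH)
      fix j assume j: "j \<ge> int (g * i' ^ 2)"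
      \<comment> \<open>Here i^2 = i'^2 + 2i' + 1 with i' at most n.\<close>
      have "g * i ^ 2 \<le> g * (i' ^ 2 + (2 * n + 1))"
        using i by (intro mult_left_mono) (simp_all add: power2_eq_square)
      then have "int (g * i ^ 2) \<le> int (g * i' ^ 2) + int (g * (2 * n + 1))"
        unfolding of_nat_add[symmetric] of_nat_le_iff by (simp add: algebra_simps)
      then have "j + int (g * (2 * n + 1)) \<ge> int (g * i ^ 2)" using j by simp
      from Suc.prems[OF this] show "q (- j) * (q (- int (g * (2 * n + 1))) * x) \<in> P"
        by (simp add: q_merge algebra_simps)
    qed
    then have "q (- int (g * (2 * n + 1))) * gbin g n i' * x \<in> P"
      by (simp add: gbin_left mult.assoc)
    then show ?thesis using 1 i by (simp add: distrib_right P_add)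
  qed
qed

end

text \<open>Y0, ..., Y4 stand for five consecutive cluster variables, and E for the standard monomials of
  the seed (Y1, Y2); the seed (Y2, Y3) is reached by replacing Y0 with Y4. Keeping the two exchange
  exponents arbitrary covers seeds of both parities, and, in the opposite ring, both directions.\<close>

locale seed_change = qinv_module q P for q :: "int \<Rightarrow> 'a :: ring_1_no_zero_divisors" and P +
  fixes Y0 Y1 Y2 Y3 Y4 :: 'a and \<beta> \<gamma> :: nat
  assumes \<beta>: "\<beta> \<ge> 1" and \<gamma>: "\<gamma> \<ge> 1"
    and Y01: "Y0 * Y1 = q 2 * (Y1 * Y0)" and Y12: "Y1 * Y2 = q 2 * (Y2 * Y1)"
    and Y23: "Y2 * Y3 = q 2 * (Y3 * Y2)" and Y34: "Y3 * Y4 = q 2 * (Y4 * Y3)"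
    and Y02: "Y0 * Y2 = q (int \<beta>) * Y1 ^ \<beta> + 1"
    and Y20: "Y2 * Y0 = q (- int \<beta>) * Y1 ^ \<beta> + 1"
    and Y31: "Y3 * Y1 = q (- int \<gamma>) * Y2 ^ \<gamma> + 1"
    and Y42: "Y4 * Y2 = q (- int \<beta>) * Y3 ^ \<beta> + 1"
    and Y2_nz: "Y2 \<noteq> 0"
    and E_in_lat: "q (- 1) * (q (- (a * b)) * Y3 ^ nat (- a) * Y1 ^ nat a * Y2 ^ nat b * Y0 ^ nat (- b)) \<in> P"
begin

lemmas Y21 = qcommute_sym[OF Y12] and Y32 = qcommute_sym[OF Y23] and Y43 = qcommute_sym[OF Y34]

definition E :: "int \<Rightarrow> int \<Rightarrow> 'a" where
  "E a b = q (- (a * b)) * Y3 ^ nat (- a) * Y1 ^ nat a * Y2 ^ nat b * Y0 ^ nat (- b)"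

definition mword :: "nat \<Rightarrow> nat \<Rightarrow> nat \<Rightarrow> nat \<Rightarrow> 'a" where
  "mword a c d b = Y3 ^ a * (Y1 ^ c * (Y2 ^ d * Y0 ^ b))"

text \<open>The scalar of \<open>E\<close>, extended to words in which both members of an exchange
  pair \<open>Y3\<close>, \<open>Y1\<close> or \<open>Y2\<close>, \<open>Y0\<close> may
  occur.\<close>

definition M :: "nat \<Rightarrow> nat \<Rightarrow> nat \<Rightarrow> nat \<Rightarrow> 'a" where
  "M a c d b = q (- ((int c - int a) * (int d - int b))) * mword a c d b"

lemma mword_M: "mword a c d b = q ((int c - int a) * (int d - int b)) * M a c d b"
  by (simp add: M_def q_merge)

lemma E_lat: "lat (E a b)"
  unfolding E_def by (rule latI) (rule E_in_lat)

lemma mword_31: "mword (Suc a) (Suc c) d b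
    = mword a c d b + q (- int \<gamma> - 2 * int \<gamma> * int c) * mword a c (d + \<gamma>) b"
proof -
  have "mword (Suc a) (Suc c) d b = Y3 ^ a * (Y3 * Y1 * (Y1 ^ c * (Y2 ^ d * Y0 ^ b)))"
    unfolding mword_def power_Suc2[of Y3] by (simp add: mult.assoc)
  also have "\<dots> = mword a c d b + q (- int \<gamma>) * (Y3 ^ a * (Y2 ^ \<gamma> * (Y1 ^ c * (Y2 ^ d * Y0 ^ b))))"
    by (simp add: Y31 distrib_left distrib_right mult.assoc q_left_pow mword_def)
  also have "Y2 ^ \<gamma> * (Y1 ^ c * (Y2 ^ d * Y0 ^ b))
      = q (- 2 * int \<gamma> * int c) * (Y1 ^ c * (Y2 ^ (d + \<gamma>) * Y0 ^ b))"
    by (subst power_qcommute'[OF Y21]) (simp add: power_add add.commute[of d] mult.assoc)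
  finally show ?thesis by (simp add: q_left_pow q_merge mword_def)
qed

lemma mword_20: "mword a c (Suc d) (Suc b)
    = mword a c d b + q (- int \<beta> - 2 * int \<beta> * int d) * mword a (c + \<beta>) d b"
proof -
  have "mword a c (Suc d) (Suc b) = Y3 ^ a * (Y1 ^ c * (Y2 ^ d * (Y2 * Y0 * Y0 ^ b)))"
    unfolding mword_def power_Suc2[of Y2] by (simp add: mult.assoc)
  also have "\<dots> = mword a c d b + q (- int \<beta>) * (Y3 ^ a * (Y1 ^ c * (Y2 ^ d * (Y1 ^ \<beta> * Y0 ^ b))))"
    by (simp add: Y20 distrib_left distrib_right mult.assoc q_left_pow mword_def)
  also have "Y2 ^ d * (Y1 ^ \<beta> * Y0 ^ b) = q (- 2 * int \<beta> * int d) * (Y1 ^ \<beta> * (Y2 ^ d * Y0 ^ b))"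
    by (subst power_qcommute'[OF Y21]) (simp add: mult_ac)
  finally show ?thesis by (simp add: q_left_pow q_merge mword_def power_add mult.assoc)
qed

lemma M_31: "M (Suc a) (Suc c) d b = M a c d b + q (- int (\<gamma> * (a + c + 1))) * M a c (d + \<gamma>) b"
proof -
  have "- ((int c - int a) * (int d - int b)) + (- int \<gamma> - 2 * int \<gamma> * int c)
     = - int (\<gamma> * (a + c + 1)) + - ((int c - int a) * (int (d + \<gamma>) - int b))"
    by (simp add: algebra_simps)
  moreover have "int (Suc c) - int (Suc a) = int c - int a" by simp
  ultimately show ?thesis unfolding M_def mword_31 distrib_left[of "q _"] q_merge by (simp only:)
qed

lemma M_20: "M a c (Suc d) (Suc b) = M a c d b + q (- int (\<beta> * (d + b + 1))) * M a (c + \<beta>) d b"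
proof -
  have "- ((int c - int a) * (int d - int b)) + (- int \<beta> - 2 * int \<beta> * int d)
     = - int (\<beta> * (d + b + 1)) + - ((int (c + \<beta>) - int a) * (int d - int b))"
    by (simp add: algebra_simps)
  moreover have "int (Suc d) - int (Suc b) = int d - int b" by simp
  ultimately show ?thesis unfolding M_def mword_20 distrib_left[of "q _"] q_merge by (simp only:)
qed

text \<open>Each use of \<open>M_31\<close> or \<open>M_20\<close> lowers a + b. Its first term
  keeps the index (c-a, d-b); its second is a lattice element by induction, multiplied by a negative
  power of v. When no exchange pair is left, the word is \<open>E\<close> itself.\<close>

lemma M_cong_E: "M a c d b - E (int c - int a) (int d - int b) \<in> P"
proof (induction "a + b" arbitrary: a c d b rule: less_induct)
  case less
  have M_lat: "lat (M a' c' d' b')" if "a' + b' < a + b" for a' c' d' b'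
    using less[OF that] E_lat lat_cong by blast
  consider a' c' where "a = Suc a'" "c = Suc c'" | b' d' where "b = Suc b'" "d = Suc d'"
    | "a = 0 \<or> c = 0" "b = 0 \<or> d = 0"
    by (metis not0_implies_Suc)
  then show ?case
  proof cases
    case 1
    have "q (- int (\<gamma> * (a' + c' + 1))) * M a' c' (d + \<gamma>) b \<in> P"
      by (rule latD[OF M_lat]) (use 1 \<gamma> in \<open>auto simp flip: of_nat_mult\<close>)
    from P_add[OF less[of a' b c' d] this] 1 show ?thesis by (simp add: M_31 algebra_simps)
  next
    case 2
    have "q (- int (\<beta> * (d' + b' + 1))) * M a (c + \<beta>) d' b' \<in> P"
      by (rule latD[OF M_lat]) (use 2 \<beta> in \<open>auto simp flip: of_nat_mult\<close>)
    from P_add[OF less[of a b' c d'] this] 2 show ?thesis by (simp add: M_20 algebra_simps)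
  next
    case 3
    then have "M a c d b = E (int c - int a) (int d - int b)"
      by (auto simp: M_def E_def mword_def mult.assoc)
    then show ?thesis by simp
  qed
qed

lemma M_lat: "lat (M a c d b)"
  using M_cong_E E_lat lat_cong by blast

text \<open>Multiply by \<open>Y2\<close> on the right. By \<open>Y02\<close> the first term becomes
  \<open>Y3 ^ \<beta> * Y1 ^ \<beta>\<close> plus the monomial of \<open>Y4 * Y2\<close>; the
  expansion of \<open>Y3 ^ \<beta> * Y1 ^ \<beta>\<close> in powers of \<open>Y2\<close> has
  constant term 1, and its remaining terms are what the sum removes. Then \<open>Y2\<close> is
  cancelled.\<close>

lemma Y4_eq: "Y4 = q (- int \<beta>) * (Y3 ^ \<beta> * Y0) - (\<Sum>k=1..\<beta>. gbin \<gamma> \<beta> k * Y2 ^ (\<gamma> * k - 1))"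
proof -
  have "(\<Sum>k=1..\<beta>. gbin \<gamma> \<beta> k * Y2 ^ (\<gamma> * k - 1)) * Y2 = (\<Sum>k=1..\<beta>. gbin \<gamma> \<beta> k * Y2 ^ (\<gamma> * k))"
  proof (subst sum_distrib_right, rule sum.cong[OF refl])
    fix k assume "k \<in> {1..\<beta>}"
    then have "\<gamma> * k = Suc (\<gamma> * k - 1)" using \<gamma> by simp
    then have "Y2 ^ (\<gamma> * k) = Y2 ^ (\<gamma> * k - 1) * Y2" by (metis power_Suc2)
    then show "gbin \<gamma> \<beta> k * Y2 ^ (\<gamma> * k - 1) * Y2 = gbin \<gamma> \<beta> k * Y2 ^ (\<gamma> * k)"
      by (simp add: mult.assoc)
  qed
  also have "\<dots> = Y3 ^ \<beta> * Y1 ^ \<beta> - 1"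
    by (simp add: power_mult_power_gbin[OF Y31 Y21] sum.atMost_shift sum.atLeast1_atMost_eq
        lessThan_Suc_atMost)
  finally have "(q (- int \<beta>) * (Y3 ^ \<beta> * Y0) - (\<Sum>k=1..\<beta>. gbin \<gamma> \<beta> k * Y2 ^ (\<gamma> * k - 1))) * Y2
      = q (- int \<beta>) * (Y3 ^ \<beta> * (Y0 * Y2)) - (Y3 ^ \<beta> * Y1 ^ \<beta> - 1)"
    by (simp add: left_diff_distrib mult.assoc)
  also have "\<dots> = Y4 * Y2"
    by (simp add: Y02 Y42 distrib_left q_left_pow q_merge)
  finally show ?thesis using Y2_nz by simp
qed

text \<open>In this order, replacing the last \<open>Y4\<close> by its leading term needs only
  commutations inside clusters: \<open>Y3 ^ \<beta>\<close> moves left over the other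
  \<open>Y4\<close>, and \<open>Y0\<close> moves right over \<open>Y1\<close>.\<close>

definition vword :: "nat \<Rightarrow> nat \<Rightarrow> nat \<Rightarrow> nat \<Rightarrow> 'a" where
  "vword a n c b = Y3 ^ a * (Y4 ^ n * (Y1 ^ c * Y0 ^ b))"

text \<open>The power of v with which the leading exponent occurs in the word.\<close>

definition vdeg :: "nat \<Rightarrow> nat \<Rightarrow> nat \<Rightarrow> nat \<Rightarrow> int" where
  "vdeg a n c b = int (a * n) + int (n * c) - (int c - int a - int (\<beta> * n)) * int b"

lemma vword_Suc: "vword a (Suc m) c b
    = q (- int \<beta> - 2 * int \<beta> * int m + 2 * int c) * vword (a + \<beta>) m c (Suc b)
      - (\<Sum>k=1..\<beta>. gbin \<gamma> \<beta> k * (Y3 ^ a * (Y4 ^ m * (Y2 ^ (\<gamma> * k - 1) * (Y1 ^ c * Y0 ^ b)))))"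
proof -
  have "vword a (Suc m) c b = Y3 ^ a * (Y4 ^ m * (Y4 * (Y1 ^ c * Y0 ^ b)))"
    unfolding vword_def power_Suc2[of Y4] by (simp add: mult.assoc)
  also have "Y4 * (Y1 ^ c * Y0 ^ b) = q (- int \<beta>) * (Y3 ^ \<beta> * (Y0 ^ 1 * (Y1 ^ c * Y0 ^ b)))
      - (\<Sum>k=1..\<beta>. gbin \<gamma> \<beta> k * (Y2 ^ (\<gamma> * k - 1) * (Y1 ^ c * Y0 ^ b)))"
    by (subst Y4_eq) (simp add: left_diff_distrib sum_distrib_right mult.assoc)
  also have "Y0 ^ 1 * (Y1 ^ c * Y0 ^ b) = q (2 * int c) * (Y1 ^ c * Y0 ^ Suc b)"
    by (subst power_qcommute'[OF Y01]) simp
  finally have "vword a (Suc m) c b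
      = q (- int \<beta> + 2 * int c) * (Y3 ^ a * (Y4 ^ m * (Y3 ^ \<beta> * (Y1 ^ c * Y0 ^ Suc b))))
      - (\<Sum>k=1..\<beta>. gbin \<gamma> \<beta> k * (Y3 ^ a * (Y4 ^ m * (Y2 ^ (\<gamma> * k - 1) * (Y1 ^ c * Y0 ^ b)))))"
    by (simp add: right_diff_distrib q_left_pow q_merge sum_distrib_left gbin_left[of "_ ^ _"]
        del: power_Suc)
  also have "Y4 ^ m * (Y3 ^ \<beta> * (Y1 ^ c * Y0 ^ Suc b))
      = q (- 2 * int \<beta> * int m) * (Y3 ^ \<beta> * (Y4 ^ m * (Y1 ^ c * Y0 ^ Suc b)))"
    by (subst power_qcommute'[OF Y43]) (simp add: mult_ac del: power_Suc)
  also have "q (- int \<beta> + 2 * int c) * (Y3 ^ a * (q (- 2 * int \<beta> * int m)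
        * (Y3 ^ \<beta> * (Y4 ^ m * (Y1 ^ c * Y0 ^ Suc b)))))
      = q (- int \<beta> - 2 * int \<beta> * int m + 2 * int c) * vword (a + \<beta>) m c (Suc b)"
    unfolding vword_def power_add mult.assoc[of "_ ^ _"] q_left_pow q_merge
    by (rule arg_cong[where f = "\<lambda>k. q k * _"]) simp
  finally show ?thesis .
qed

text \<open>Disposes of the terms of \<open>Y4_eq\<close> that contain powers of \<open>Y2\<close>.
  Expanding \<open>Y4\<close> against \<open>Y2\<close> leaves powers of \<open>Y3\<close> and
  either surplus factors \<open>Y4\<close>, covered by the hypothesis on shorter words, or surplus
  factors \<open>Y2\<close>, covered by \<open>M_lat\<close>. The degree is that of the word with
  \<open>Suc m\<close> factors \<open>Y4\<close>, from which these terms arise.\<close>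

lemma vword_correction:
  assumes lat: "\<And>a' n' c' b'. n' \<le> m \<Longrightarrow> lat (q (- vdeg a' n' c' b') * vword a' n' c' b')"
    and e: "e \<ge> 1"
  shows "q (- e - vdeg a (Suc m) c b) * (Y3 ^ a * (Y4 ^ m * (Y2 ^ j * (Y1 ^ c * Y0 ^ b)))) \<in> P"
proof (cases "j \<le> m")
  case True
  then obtain l where l: "m = l + j" by (metis le_add_diff_inverse2)
  let ?t = "\<lambda>i. Y3 ^ a * (Y4 ^ l * (Y3 ^ (\<beta> * i) * (Y1 ^ c * Y0 ^ b)))"
  have "Y4 ^ m * (Y2 ^ j * (Y1 ^ c * Y0 ^ b)) = Y4 ^ l * ((Y4 ^ j * Y2 ^ j) * (Y1 ^ c * Y0 ^ b))"
    by (simp add: l power_add mult.assoc)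
  also have "\<dots> = (\<Sum>i\<le>j. gbin \<beta> j i * (Y4 ^ l * (Y3 ^ (\<beta> * i) * (Y1 ^ c * Y0 ^ b))))"
    by (simp add: power_mult_power_gbin[OF Y42 Y32] sum_distrib_left sum_distrib_right
        gbin_left[of "_ ^ _"] mult.assoc)
  finally have eq: "q (- e - vdeg a (Suc m) c b) * (Y3 ^ a * (Y4 ^ m * (Y2 ^ j * (Y1 ^ c * Y0 ^ b))))
     = (\<Sum>i\<le>j. gbin \<beta> j i * (q (- e - vdeg a (Suc m) c b) * ?t i))"
    by (simp add: sum_distrib_left gbin_left[of "_ ^ _"] gbin_left[of "q _"])
  show ?thesis unfolding eq
  proof (intro P_sum gbin_mem)
    fix i e' assume i: "i \<in> {..j}" and e': "int (\<beta> * i\<^sup>2) \<le> e'"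
    have t: "?t i = q (- 2 * int l * int (\<beta> * i)) * vword (a + \<beta> * i) l c b"
      by (subst power_qcommute'[OF Y43])
         (simp add: vword_def power_add q_left_pow mult.assoc)
    define x where "x = int (j - i)"
    have x: "int j = int i + x" "x \<ge> 0" using i by (auto simp: x_def)
    \<comment> \<open>The total exponent is split into the normalising exponent of the remaining
      word and -e minus manifestly nonnegative quantities.\<close>
    have "- e' + (- e - vdeg a (Suc m) c b) + (- 2 * int l * int (\<beta> * i))
       = (- e - e' - int \<beta> * int i * int l - (int a + int c) * (int j + 1) - int b * int \<beta> * (x + 1))
         + - vdeg (a + \<beta> * i) l c b"
      unfolding vdeg_def l using x by (simp add: algebra_simps)
    then have "q (- e') * (q (- e - vdeg a (Suc m) c b) * ?t i)
       = q (- e - e' - int \<beta> * int i * int l - (int a + int c) * (int j + 1) - int b * int \<beta> * (x + 1))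
         * (q (- vdeg (a + \<beta> * i) l c b) * vword (a + \<beta> * i) l c b)"
      unfolding t q_merge by (simp only: add.assoc)
    also have "\<dots> \<in> P"
    proof (rule latD[OF lat])
      have "int (\<beta> * i\<^sup>2) \<ge> 0" by simp
      moreover have "int \<beta> * int i * int l \<ge> 0" "(int a + int c) * (int j + 1) \<ge> 0"
        "int b * int \<beta> * (x + 1) \<ge> 0" using x by simp_all
      ultimately show "- e - e' - int \<beta> * int i * int l - (int a + int c) * (int j + 1)
         - int b * int \<beta> * (x + 1) \<le> - 1" using e e' by linarith
    qed (simp add: l)
    finally show "q (- e') * (q (- e - vdeg a (Suc m) c b) * ?t i) \<in> P" .
  qed
next
  case False
  then obtain l where l: "j = m + l" by (metis nat_le_linear le_add_diff_inverse)
  let ?t = "\<lambda>i. Y3 ^ a * (Y3 ^ (\<beta> * i) * (Y2 ^ l * (Y1 ^ c * Y0 ^ b)))"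
  have "Y4 ^ m * (Y2 ^ j * (Y1 ^ c * Y0 ^ b)) = (Y4 ^ m * Y2 ^ m) * (Y2 ^ l * (Y1 ^ c * Y0 ^ b))"
    by (simp add: l power_add mult.assoc)
  also have "\<dots> = (\<Sum>i\<le>m. gbin \<beta> m i * (Y3 ^ (\<beta> * i) * (Y2 ^ l * (Y1 ^ c * Y0 ^ b))))"
    by (simp add: power_mult_power_gbin[OF Y42 Y32] sum_distrib_right mult.assoc)
  finally have eq: "q (- e - vdeg a (Suc m) c b) * (Y3 ^ a * (Y4 ^ m * (Y2 ^ j * (Y1 ^ c * Y0 ^ b))))
     = (\<Sum>i\<le>m. gbin \<beta> m i * (q (- e - vdeg a (Suc m) c b) * ?t i))"
    by (simp add: sum_distrib_left gbin_left[of "_ ^ _"] gbin_left[of "q _"])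
  show ?thesis unfolding eq
  proof (intro P_sum gbin_mem)
    fix i e' assume i: "i \<in> {..m}" and e': "int (\<beta> * i\<^sup>2) \<le> e'"
    have t: "?t i = q (- 2 * int l * int c) * mword (a + \<beta> * i) c l b"
      by (subst power_qcommute'[OF Y21])
         (simp add: mword_def power_add q_left_pow mult.assoc)
    define x where "x = int (m - i)"
    have x: "int m = int i + x" "x \<ge> 0" using i by (auto simp: x_def)
    have "- e' + (- e - vdeg a (Suc m) c b) + (- 2 * int l * int c)
         + (int c - int (a + \<beta> * i)) * (int l - int b)
       = - e - e' - int c * (int j + 1) - int a * (int j + 1) - int \<beta> * int i * int l
         - int b * int \<beta> * (x + 1)"
      unfolding vdeg_def l using x by (simp add: algebra_simps)
    then have "q (- e') * (q (- e - vdeg a (Suc m) c b) * ?t i)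
       = q (- e - e' - int c * (int j + 1) - int a * (int j + 1) - int \<beta> * int i * int l
         - int b * int \<beta> * (x + 1)) * M (a + \<beta> * i) c l b"
      unfolding t q_merge mword_M by (simp only: add.assoc)
    also have "\<dots> \<in> P"
    proof (rule latD[OF M_lat])
      have "int (\<beta> * i\<^sup>2) \<ge> 0" by simp
      moreover have "int \<beta> * int i * int l \<ge> 0" "int a * (int j + 1) \<ge> 0" "int c * (int j + 1) \<ge> 0"
        "int b * int \<beta> * (x + 1) \<ge> 0" using x by simp_all
      ultimately show "- e - e' - int c * (int j + 1) - int a * (int j + 1) - int \<beta> * int i * int l
         - int b * int \<beta> * (x + 1) \<le> - 1" using e e' by linarith
    qed
    finally show "q (- e') * (q (- e - vdeg a (Suc m) c b) * ?t i) \<in> P" .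
  qed
qed

text \<open>One \<open>Y4\<close> at a time is replaced by the leading term of \<open>Y4_eq\<close>,
  which preserves the index; with none left the word is an \<open>M\<close>.\<close>

lemma vword_cong_E:
  "q (- vdeg a n c b) * vword a n c b - E (int c - int a - int (\<beta> * n)) (- int n - int b) \<in> P"
proof (induction n arbitrary: a c b rule: less_induct)
  case (less n)
  show ?case
  proof (cases n)
    case 0
    have "q (- vdeg a n c b) * vword a n c b = M a c 0 b"
      by (simp add: 0 vdeg_def vword_def M_def mword_def)
    then show ?thesis using M_cong_E[of a c 0 b] 0 by simp
  next
    case (Suc m)
    have lat: "lat (q (- vdeg a' n' c' b') * vword a' n' c' b')" if "n' \<le> m" for a' n' c' b'
      using less[of n' a' c' b'] that Suc E_lat lat_cong by (metis less_Suc_eq_le)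
    have deg: "- vdeg a (Suc m) c b + (- int \<beta> - 2 * int \<beta> * int m + 2 * int c)
        = - vdeg (a + \<beta>) m c (Suc b)"
      by (simp add: vdeg_def algebra_simps)
    let ?t = "\<lambda>k. Y3 ^ a * (Y4 ^ m * (Y2 ^ (\<gamma> * k - 1) * (Y1 ^ c * Y0 ^ b)))"
    have eq: "q (- vdeg a n c b) * vword a n c b
      = q (- vdeg (a + \<beta>) m c (Suc b)) * vword (a + \<beta>) m c (Suc b)
       - (\<Sum>k=1..\<beta>. gbin \<gamma> \<beta> k * (q (- vdeg a (Suc m) c b) * ?t k))"
      unfolding Suc vword_Suc right_diff_distrib q_merge deg
      by (simp add: sum_distrib_left gbin_left[of "q _"])
    have sum: "(\<Sum>k=1..\<beta>. gbin \<gamma> \<beta> k * (q (- vdeg a (Suc m) c b) * ?t k)) \<in> P"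
    proof (intro P_sum gbin_mem)
      fix k e assume k: "k \<in> {1..\<beta>}" and e: "int (\<gamma> * k\<^sup>2) \<le> e"
      \<comment> \<open>The sum starts at k = 1, so the Gaussian coefficient itself supplies the
        factor v^-1 that puts the correction into P.\<close>
      have "int (\<gamma> * k\<^sup>2) \<ge> 1" using k \<gamma> by (simp flip: of_nat_power of_nat_mult)
      then show "q (- e) * (q (- vdeg a (Suc m) c b) * ?t k) \<in> P"
        using vword_correction[OF lat, of m e a c b "\<gamma> * k - 1"] e by (simp add: q_merge)
    qed
    have E: "E (int c - int (a + \<beta>) - int (\<beta> * m)) (- int m - int (Suc b))
        = E (int c - int a - int (\<beta> * n)) (- int n - int b)"
      by (rule arg_cong2[where f = E]) (simp_all add: Suc algebra_simps)
    have "m < n" by (simp add: Suc)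
    from P_diff[OF less[OF this, of "a + \<beta>" c "Suc b"] sum] show ?thesis
      unfolding eq E by (subst diff_right_commute)
  qed
qed

text \<open>For c >= 0 no \<open>Y4\<close> occurs and reordering gives equality with an
  \<open>E\<close>. The nonlinear part of the index stems from \<open>Y4\<close>, each factor of
  which contributes \<open>Y3 ^ \<beta> * Y0\<close>.\<close>

theorem seed_change_cong:
  "q (- (c * d)) * Y4 ^ nat (- c) * Y2 ^ nat c * Y3 ^ nat d * Y1 ^ nat (- d)
     - E (- d - int \<beta> * max (- c) 0) c \<in> P"
proof (cases "c \<ge> 0")
  case True
  have "Y2 ^ nat c * (Y3 ^ nat d * Y1 ^ nat (- d))
      = q (2 * (c * d)) * (Y3 ^ nat d * (Y1 ^ nat (- d) * Y2 ^ nat c))"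
  proof (cases "d \<ge> 0")
    case True
    then show ?thesis using \<open>c \<ge> 0\<close> by (simp add: power_qcommute[OF Y23] mult.assoc)
  next
    case False
    then show ?thesis using \<open>c \<ge> 0\<close> by (simp add: power_qcommute[OF Y21] mult.assoc)
  qed
  then have "q (- (c * d)) * Y4 ^ nat (- c) * Y2 ^ nat c * Y3 ^ nat d * Y1 ^ nat (- d) = E (- d) c"
    using True by (simp add: E_def mult.assoc q_merge mult.commute[of d])
  then show ?thesis using True by simp
next
  case False
  define n where "n = nat (- c)"
  have n: "c = - int n" using False by (simp add: n_def)
  show ?thesis
  proof (cases "d \<ge> 0")
    case True
    have "Y4 ^ n * Y3 ^ nat d = q (- 2 * int n * d) * (Y3 ^ nat d * Y4 ^ n)"
      using True by (simp add: power_qcommute[OF Y43])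
    then have "q (- (c * d)) * Y4 ^ nat (- c) * Y2 ^ nat c * Y3 ^ nat d * Y1 ^ nat (- d)
        = q (- vdeg (nat d) n 0 0) * vword (nat d) n 0 0"
      using True by (simp add: n vdeg_def vword_def mult.assoc q_merge algebra_simps)
    then show ?thesis using vword_cong_E[of "nat d" n 0 0] True by (simp add: n)
  next
    case False
    then have "q (- (c * d)) * Y4 ^ nat (- c) * Y2 ^ nat c * Y3 ^ nat d * Y1 ^ nat (- d)
        = q (- vdeg 0 n (nat (- d)) 0) * vword 0 n (nat (- d)) 0"
      by (simp add: n vdeg_def vword_def mult.assoc)
    then show ?thesis using vword_cong_E[of 0 n "nat (- d)" 0] False by (simp add: n)
  qed
qed

end

section \<open>Cluster variables\<close>

interpretation T: central_powers vp
  by unfold_locales (rule mon_0, rule vp_add, rule vp_central)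

definition Xd :: qtorus where "Xd = tor Xdelta"

lemma Xd_eq: "Xd = mon 0 (-1) (-2) + mon 0 (-1) 2 + mon 0 1 (-2) + mon (-1) 0 (-2) + mon 1 0 (-2)"
  by (simp add: Xd_def Xdelta_def tor_simps mon_def[symmetric] distrib_right mon_mult add.assoc)

text \<open>\<open>even_up n\<close> is to be X_(2n) and \<open>even_down n\<close> is to be
  X_(2-2n): both directions start from the pair X_0, X_2.\<close>

fun even_up :: "nat \<Rightarrow> qtorus" where
  "even_up 0 = mon 0 0 (-1) + mon 0 1 (-1)"
| "even_up (Suc 0) = mon 0 0 1"
| "even_up (Suc (Suc n)) = vp 1 * (Xd * even_up (Suc n)) - vp 2 * even_up n"

fun even_down :: "nat \<Rightarrow> qtorus" where
  "even_down 0 = mon 0 0 1"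
| "even_down (Suc 0) = mon 0 0 (-1) + mon 0 1 (-1)"
| "even_down (Suc (Suc n)) = vp (-1) * (Xd * even_down (Suc n)) - vp (-2) * even_down n"

text \<open>The variables of even index satisfy a linear recursion with coefficient X-delta, which
  defines them inside the torus without any division.\<close>

definition X_ev :: "int \<Rightarrow> qtorus" where
  "X_ev j = (if j \<ge> 0 then even_up (nat j) else even_down (nat (1 - j)))"

lemma X_ev_0: "X_ev 0 = mon 0 0 (-1) + mon 0 1 (-1)"
  and X_ev_1: "X_ev 1 = mon 0 0 1"
  by (simp_all add: X_ev_def)

lemma Xd_X_ev: "Xd * X_ev j = vp 1 * X_ev (j - 1) + vp (-1) * X_ev (j + 1)"
proof (cases "j \<ge> 1")
  case True
  then obtain n where n: "j = int n + 1" by (metis add.commute zle_iff_zadd)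
  have "nat (int n + 1 + 1) = Suc (Suc n)" "nat (int n + 1) = Suc n" by simp_all
  then show ?thesis
    by (simp add: n X_ev_def right_diff_distrib T.q_merge del: even_up.simps)
       (simp add: right_diff_distrib T.q_merge mon_0)
next
  case False
  then obtain n where n: "j = - int n" using nonpos_int_cases[of j] by auto
  have dn: "X_ev (1 - int k) = even_down k" for k
    by (cases "k = 0"; cases "k = 1") (simp_all add: X_ev_def)
  have "j = 1 - int (Suc n)" "j - 1 = 1 - int (Suc (Suc n))" "j + 1 = 1 - int n"
    by (simp_all add: n)
  then have "X_ev j = even_down (Suc n)" "X_ev (j - 1) = even_down (Suc (Suc n))" "X_ev (j + 1) = even_down n"
    by (simp_all only: dn)
  then show ?thesis by (simp add: right_diff_distrib T.q_merge mon_0)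
qed

lemma X_ev_succ: "X_ev (j + 1) = vp 1 * (Xd * X_ev j) - vp 2 * X_ev (j - 1)"
  by (simp add: Xd_X_ev distrib_left T.q_merge mon_0)

lemma X_ev_pred: "X_ev (j - 1) = vp (-1) * (Xd * X_ev j) - vp (-2) * X_ev (j + 1)"
  by (simp add: Xd_X_ev distrib_left T.q_merge mon_0)

lemma X_ev_2: "X_ev 2 = mon 0 (-1) (-1) + mon 0 (-1) 3 + mon 0 0 (-1)"
  using X_ev_succ[of 1] by (simp add: X_ev_0 X_ev_1 Xd_eq algebra_simps mon_mult)

lemmas vp_out = T.q_left[of Xd] T.q_left[of "X_ev _"] T.q_merge mult.assoc

text \<open>This is the bar image of \<open>Xd_X_ev\<close>, but bar invariance of the variables is
  itself derived from it. Two consecutive instances propagate along the recursion, so only j = 0 and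
  j = 1 are computed in the torus.\<close>

lemma X_ev_Xd: "X_ev j * Xd = vp (-1) * X_ev (j - 1) + vp 1 * X_ev (j + 1)"
proof -
  let ?R = "\<lambda>j. X_ev j * Xd = vp (-1) * X_ev (j - 1) + vp 1 * X_ev (j + 1)"
  have "?R j \<and> ?R (j + 1)"
  proof (induction j rule: int_induct[of _ 0])
    case base
    have m1: "X_ev (-1) = vp (-1) * (Xd * X_ev 0) - vp (-2) * X_ev 1" using X_ev_pred[of 0] by simp
    show ?case
      by (simp add: m1) (simp add: X_ev_0 X_ev_1 X_ev_2 Xd_eq algebra_simps mon_mult)
  next
    case (step1 i)
    have "X_ev (i + 1 + 1) * Xd = vp 1 * (Xd * (X_ev (i + 1) * Xd)) - vp 2 * (X_ev i * Xd)"
      by (subst X_ev_succ) (simp add: left_diff_distrib mult.assoc)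
    also have "\<dots> = vp (-1) * X_ev (i + 1 + 1 - 1) + vp 1 * X_ev (i + 1 + 1 + 1)"
      using step1 by (simp add: Xd_X_ev distrib_left vp_out mon_0 add.assoc) (simp add: add.commute)
    finally show ?case using step1 by blast
  next
    case (step2 i)
    have "X_ev (i - 1) * Xd = vp (-1) * (Xd * (X_ev i * Xd)) - vp (-2) * (X_ev (i + 1) * Xd)"
      by (subst X_ev_pred) (simp add: left_diff_distrib mult.assoc)
    also have "\<dots> = vp (-1) * X_ev (i - 1 - 1) + vp 1 * X_ev (i - 1 + 1)"
      using step2 by (simp add: Xd_X_ev distrib_left vp_out mon_0 add.assoc)
    finally show ?case using step2 by simp
  qed
  then show ?thesis by blast
qed

section \<open>Quadratic relations between variables of even index\<close>

lemma shift_invariant_const: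
  assumes "\<And>j :: int. f (j + 1) = f j"
  shows "f j = f k"
proof (induction j rule: int_induct[of _ k])
  case (step2 i) then show ?case using assms[of "i - 1"] by simp
qed (simp_all add: assms)

text \<open>Absorbing X_delta to the left or to the right in X_(2j+2) X_delta X_(2j+2) shows that
  the q-commutator is independent of j; its value is computed at j = 0. The next two relations
  follow in the same way.\<close>

lemma X_ev_qcomm: "X_ev j * X_ev (j + 1) = vp 2 * (X_ev (j + 1) * X_ev j) + 1 - vp 2"
proof -
  let ?f = "\<lambda>j. X_ev j * X_ev (j + 1) - vp 2 * (X_ev (j + 1) * X_ev j)"
  have "?f (j + 1) = ?f j" for j
  proof -
    have "vp 1 * (X_ev (j + 1) * Xd * X_ev (j + 1)) = vp 1 * (X_ev (j + 1) * (Xd * X_ev (j + 1)))"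
      by (simp add: mult.assoc)
    then show ?thesis
      unfolding X_ev_Xd Xd_X_ev
      by (simp add: distrib_left distrib_right vp_out mon_0 algebra_simps)
  qed
  then have "?f j = ?f 0" by (rule shift_invariant_const)
  also have "?f 0 = 1 - vp 2"
    by (simp add: X_ev_0 X_ev_1 algebra_simps mon_mult mon_0)
  finally show ?thesis by (simp add: algebra_simps)
qed

lemma X_ev_succ_pred: "X_ev (j + 1) * X_ev (j - 1) = vp 1 * Xd + vp (-2) * (X_ev j * X_ev j)"
proof -
  let ?f = "\<lambda>j. X_ev (j + 1) * X_ev (j - 1) - vp (-2) * (X_ev j * X_ev j)"
  have "?f (j + 1) = ?f j" for j
  proof -
    have "vp (-1) * (X_ev (j + 1) * Xd * X_ev j) = vp (-1) * (X_ev (j + 1) * (Xd * X_ev j))"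
      by (simp add: mult.assoc)
    then show ?thesis
      unfolding X_ev_Xd Xd_X_ev
      by (simp add: distrib_left distrib_right vp_out mon_0 algebra_simps)
  qed
  then have "?f j = ?f 1" by (rule shift_invariant_const)
  also have "?f 1 = vp 1 * Xd"
    by (simp add: X_ev_0 X_ev_1 X_ev_2 Xd_eq algebra_simps mon_mult mon_0)
  finally show ?thesis by (simp add: algebra_simps)
qed

lemma X_ev_pred_succ: "X_ev (j - 1) * X_ev (j + 1) = vp (-1) * Xd + vp 2 * (X_ev j * X_ev j)"
proof -
  let ?f = "\<lambda>j. X_ev (j - 1) * X_ev (j + 1) - vp 2 * (X_ev j * X_ev j)"
  have "?f (j + 1) = ?f j" for j
  proof -
    have "vp 1 * (X_ev j * Xd * X_ev (j + 1)) = vp 1 * (X_ev j * (Xd * X_ev (j + 1)))"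
      by (simp add: mult.assoc)
    then show ?thesis
      unfolding X_ev_Xd Xd_X_ev
      by (simp add: distrib_left distrib_right vp_out mon_0 algebra_simps)
  qed
  then have "?f j = ?f 1" by (rule shift_invariant_const)
  also have "?f 1 = vp (-1) * Xd"
    by (simp add: X_ev_0 X_ev_1 X_ev_2 Xd_eq algebra_simps mon_mult mon_0)
  finally show ?thesis by (simp add: algebra_simps)
qed

lemma bar_Xd: "bar Xd = Xd"
  by (simp add: Xd_eq bar_simps algebra_simps)

lemma bar_X_ev: "bar (X_ev j) = X_ev j"
proof -
  have "bar (X_ev j) = X_ev j \<and> bar (X_ev (j + 1)) = X_ev (j + 1)"
  proof (induction j rule: int_induct[of _ 0])
    case base
    show ?case by (simp add: X_ev_0 X_ev_1 bar_simps)
  next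
    case (step1 i)
    have "bar (X_ev (i + 1 + 1)) = X_ev (i + 1) * Xd * vp (-1) - X_ev i * vp (-2)"
      by (subst X_ev_succ) (simp add: step1 bar_simps bar_Xd)
    also have "\<dots> = X_ev (i + 1 + 1)"
      by (simp add: X_ev_Xd vp_central[of "_ + _"] vp_central[of "X_ev _"] distrib_left T.q_merge mon_0)
    finally show ?case using step1 by simp
  next
    case (step2 i)
    have "bar (X_ev (i - 1)) = X_ev i * Xd * vp 1 - X_ev (i + 1) * vp 2"
      by (subst X_ev_pred) (simp add: step2 bar_simps bar_Xd)
    also have "\<dots> = X_ev (i - 1)"
      by (simp add: X_ev_Xd vp_central[of "_ + _"] vp_central[of "X_ev _"] distrib_left T.q_merge mon_0)
    finally show ?case using step2 by simp
  qed
  then show ?thesis by blast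
qed

text \<open>The exchange relation at the odd place 2j+1, solved for X_(2j+1).\<close>

definition X_od :: "int \<Rightarrow> qtorus" where
  "X_od j = vp (-1) * (X_ev j * X_ev (j + 1) - 1)"

lemma X_ev_X_ev_up: "X_ev j * X_ev (j + 1) = vp 1 * X_od j + 1"
  by (simp add: X_od_def T.q_merge mon_0)

lemma bar_X_od: "bar (X_od j) = X_od j"
proof -
  have "bar (X_od j) = vp 1 * (X_ev (j + 1) * X_ev j - 1)"
    by (simp add: X_od_def bar_simps bar_X_ev vp_central[of "_ - _"])
  also have "\<dots> = X_od j"
    by (simp add: X_od_def X_ev_qcomm right_diff_distrib distrib_left T.q_merge vp_add[symmetric])
  finally show ?thesis .
qed

lemma X_ev_X_ev_down: "X_ev (j + 1) * X_ev j = vp (-1) * X_od j + 1"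
  using arg_cong[OF X_ev_X_ev_up[of j], of bar]
  by (simp add: bar_simps bar_X_ev bar_X_od vp_central[of "X_od _"])

lemma X_ev_X_od: "X_ev j * X_od j = vp 2 * (X_od j * X_ev j)"
proof -
  have "X_ev j * X_od j = vp (-1) * (X_ev j * (X_ev j * X_ev (j + 1)) - X_ev j)"
    by (simp add: X_od_def vp_central[of "X_ev _"] T.q_left[of "X_ev _"] right_diff_distrib)
  also have "X_ev j * (X_ev j * X_ev (j + 1)) - X_ev j = vp 2 * (X_ev j * X_ev (j + 1) * X_ev j - X_ev j)"
    by (subst X_ev_qcomm)
       (simp add: right_diff_distrib distrib_left vp_out vp_central[of "X_ev _"])
  finally show ?thesis by (simp add: X_od_def T.q_merge left_diff_distrib mult.assoc right_diff_distrib vp_central[of "X_ev _"])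
qed

lemma X_od_X_ev: "X_od j * X_ev (j + 1) = vp 2 * (X_ev (j + 1) * X_od j)"
proof -
  have "X_ev (j + 1) * (X_ev j * X_ev (j + 1)) = vp (-2) * ((X_ev j * X_ev (j + 1) - 1 + vp 2) * X_ev (j + 1))"
    by (subst (2) X_ev_qcomm) (simp add: T.q_merge mon_0 mult.assoc)
  then show ?thesis
    by (simp add: X_od_def T.q_merge T.q_left[of "X_ev _"] left_diff_distrib mult.assoc
        right_diff_distrib distrib_left distrib_right mon_0 vp_central[of "X_ev _"])
qed

text \<open>In y x x z the factor y is carried over both x, y z is turned into X_delta and x^2, and
  x X_delta is turned back into neighbours of x. The remaining products of two variables cancel
  against those produced by the -1 in \<open>X_od\<close>.\<close>

lemma X_od_X_od: "X_od (j - 1) * X_od j = vp 4 * X_ev j ^ 4 + 1"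
proof -
  let ?x = "X_ev j" and ?y = "X_ev (j - 1)" and ?z = "X_ev (j + 1)"
  have yx: "?y * ?x = vp 2 * (?x * ?y) + 1 - vp 2" using X_ev_qcomm[of "j - 1"] by simp
  have yx': "?y * (?x * w) = vp 2 * (?x * (?y * w)) + w - vp 2 * w" for w
    unfolding mult.assoc[symmetric, of ?y] yx by (simp add: distrib_right left_diff_distrib mult.assoc)
  have "?y * (?x * (?x * ?z)) = vp 4 * (?x * (?x * (?y * ?z))) + ?x * ?z - vp 4 * (?x * ?z)"
    unfolding yx' distrib_left right_diff_distrib vp_out by simp
  also have "vp 4 * (?x * (?x * (?y * ?z))) = vp 6 * ?x ^ 4 + vp 3 * (?x * (?x * Xd))"
    by (simp add: X_ev_pred_succ distrib_left vp_out power4_eq_xxxx)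
  also have "vp 3 * (?x * (?x * Xd)) = vp 2 * (?x * ?y) + vp 4 * (?x * ?z)"
    by (simp add: X_ev_Xd distrib_left vp_out)
  finally have main: "?y * (?x * (?x * ?z)) = vp 6 * ?x ^ 4 + vp 2 * (?x * ?y) + ?x * ?z"
    by simp
  have "X_od (j - 1) * X_od j = vp (-2) * ((?y * ?x - 1) * (?x * ?z - 1))"
    by (simp add: X_od_def T.q_merge mult.assoc T.q_left[of "_ - _"])
  also have "(?y * ?x - 1) * (?x * ?z - 1) = ?y * (?x * (?x * ?z)) - ?y * ?x - ?x * ?z + 1"
    by (simp add: left_diff_distrib right_diff_distrib mult.assoc)
  also have "\<dots> = vp 6 * ?x ^ 4 + vp 2"
    by (simp add: main yx)
  finally show ?thesis by (simp add: distrib_left T.q_merge vp_add[symmetric] mon_0 mon_mult)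
qed

lemma X_od_xodd': "X_od j * X_od (j - 1) = vp (-4) * X_ev j ^ 4 + 1"
  using arg_cong[OF X_od_X_od[of j], of bar]
  by (simp add: bar_simps bar_X_ev bar_X_od bar_pow vp_central[of "_ ^ _"])

lemma X_od_0: "X_od 0 = mon 0 1 0"
  by (simp add: X_od_def X_ev_0 X_ev_1 algebra_simps mon_mult mon_0)

section \<open>The whole sequence of cluster variables and its uniqueness\<close>

definition X :: "int \<Rightarrow> qtorus" where
  "X k = (if even k then X_ev (k div 2) else X_od (k div 2))"

definition expo :: "int \<Rightarrow> nat" where "expo k = (if even k then 4 else 1)"

lemma X_even: "X (2 * j) = X_ev j" and X_odd: "X (2 * j + 1) = X_od j"
  by (simp_all add: X_def)

lemma X_succ: "X k * X (k + 1) = vp 2 * (X (k + 1) * X k)"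
proof (cases "even k")
  case True
  then obtain j where "k = 2 * j" by (rule evenE)
  then show ?thesis by (simp add: X_even X_odd X_ev_X_od)
next
  case False
  then obtain j where k: "k = 2 * j + 1" by (rule oddE)
  then have "k + 1 = 2 * (j + 1)" by simp
  then show ?thesis unfolding k by (simp only: X_even X_odd X_od_X_ev)
qed

lemma X_exchange_both: "X (k - 1) * X (k + 1) = vp (int (expo k)) * X k ^ expo k + 1 \<and>
   X (k + 1) * X (k - 1) = vp (- int (expo k)) * X k ^ expo k + 1"
proof (cases "even k")
  case True
  then obtain j where k: "k = 2 * j" by (rule evenE)
  then have k1: "k - 1 = 2 * (j - 1) + 1" by simp
  have e: "expo k = 4" using True by (simp add: expo_def)
  show ?thesis unfolding e k1 unfolding k
    by (simp only: X_even X_odd X_od_X_od X_od_xodd') simp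
next
  case False
  then obtain j where k: "k = 2 * j + 1" by (rule oddE)
  then have k1: "k + 1 = 2 * (j + 1)" "k - 1 = 2 * j" by simp_all
  have e: "expo k = 1" using False by (simp add: expo_def)
  show ?thesis unfolding e k1 unfolding k
    by (simp only: X_even X_odd X_ev_X_ev_up X_ev_X_ev_down) simp
qed

lemmas X_exchange = X_exchange_both[THEN conjunct1] X_exchange_both[THEN conjunct2]

lemma bar_X: "bar (X k) = X k"
  by (simp add: X_def bar_X_ev bar_X_od)

lemma expo_pos: "expo k \<ge> 1" by (simp add: expo_def)

text \<open>If X_k vanished, the two orders of the exchange relation at k+1 would give v^e x = v^-e
  x = -1 for the same power x of X_(k+1), which is impossible in a domain.\<close>

lemma X_nonzero: "X k \<noteq> 0"
proof
  assume 0: "X k = 0"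
  let ?e = "expo (k + 1)"
  have k2: "k + 1 - 1 = k" "k + 1 + 1 = k + 2" by simp_all
  have z: "vp (int ?e) * X (k + 1) ^ ?e + 1 = 0" "vp (- int ?e) * X (k + 1) ^ ?e + 1 = 0"
    using X_exchange[of "k + 1"] k2 0 by simp_all
  have "(vp (int ?e) - vp (- int ?e)) * X (k + 1) ^ ?e
      = (vp (int ?e) * X (k + 1) ^ ?e + 1) - (vp (- int ?e) * X (k + 1) ^ ?e + 1)"
    unfolding left_diff_distrib by simp
  then have "(vp (int ?e) - vp (- int ?e)) * X (k + 1) ^ ?e = 0"
    unfolding z by simp
  moreover have "vp (int ?e) - vp (- int ?e) \<noteq> 0"
    using expo_pos[of "k + 1"] by (simp add: mon_eq_iff)
  ultimately have "X (k + 1) ^ ?e = 0" by (metis no_zero_divisors)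
  then show False using z(1) by (simp only: mult_zero_right add_0 one_neq_zero)
qed

lemma exchange_unique:
  fixes Z :: "int \<Rightarrow> qtorus"
  assumes "Z 1 = X 1" "Z 2 = X 2"
    and Z: "\<And>k. Z (k - 1) * Z (k + 1) = vp (int (expo k)) * Z k ^ expo k + 1"
  shows "Z k = X k"
proof -
  have "Z k = X k \<and> Z (k + 1) = X (k + 1)"
  proof (induction k rule: int_induct[of _ 1])
    case (step1 i)
    have "X i * Z (i + 1 + 1) = X i * X (i + 1 + 1)"
      using Z[of "i + 1"] X_exchange(1)[of "i + 1"] step1 by simp
    then show ?case using step1 X_nonzero[of i] by simp
  next
    case (step2 i)
    have "Z (i - 1) * X (i + 1) = X (i - 1) * X (i + 1)"
      using Z[of i] X_exchange(1)[of i] step2 by simp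
    then show ?case using step2 X_nonzero[of "i + 1"] by simp
  qed (use assms in simp)
  then show ?thesis by blast
qed

lemma X_1: "X 1 = mon 0 1 0" and X_2: "X 2 = mon 0 0 1"
  using X_odd[of 0] X_even[of 1] by (simp_all add: X_od_0 X_ev_1)

definition exchange_seq :: "(int \<Rightarrow> qt) \<Rightarrow> bool" where
  "exchange_seq Z \<longleftrightarrow> Z 1 = qX1 \<and> Z 2 = qX2
      \<and> (\<forall>k. odd k \<longrightarrow> Z (k - 1) \<star> Z (k + 1) = qmon 1 0 0 \<star> Z k + qone)
      \<and> (\<forall>k. even k \<longrightarrow> Z (k - 1) \<star> Z (k + 1) = qmon 4 0 0 \<star> qpow (Z k) 4 + qone)"

lemma exchange_seq_iff:
  "exchange_seq Z \<longleftrightarrow> tor (Z 1) = X 1 \<and> tor (Z 2) = X 2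
     \<and> (\<forall>k. tor (Z (k - 1)) * tor (Z (k + 1)) = vp (int (expo k)) * tor (Z k) ^ expo k + 1)"
proof -
  have 1: "Z 1 = qX1 \<longleftrightarrow> tor (Z 1) = X 1" "Z 2 = qX2 \<longleftrightarrow> tor (Z 2) = X 2"
    by (simp_all only: X_1 X_2 mon_def qX1_def qX2_def tor_eq_iff)
  have 2: "Z (k - 1) \<star> Z (k + 1) = qmon 1 0 0 \<star> Z k + qone
      \<longleftrightarrow> tor (Z (k - 1)) * tor (Z (k + 1)) = vp (int (expo k)) * tor (Z k) ^ expo k + 1"
    if "odd k" for k
    by (subst tor_eq_iff[symmetric]) (simp add: that expo_def tor_simps mon_def)
  have 3: "Z (k - 1) \<star> Z (k + 1) = qmon 4 0 0 \<star> qpow (Z k) 4 + qone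
      \<longleftrightarrow> tor (Z (k - 1)) * tor (Z (k + 1)) = vp (int (expo k)) * tor (Z k) ^ expo k + 1"
    if "even k" for k
    by (subst tor_eq_iff[symmetric]) (simp add: that expo_def tor_simps tor_pow mon_def)
  show ?thesis unfolding exchange_seq_def 1 using 2 3 by blast
qed

lemma tor_clusterX: "tor (clusterX k) = X k"
proof -
  have "exchange_seq (\<lambda>k. rep (X k))"
    unfolding exchange_seq_iff rep_inverse using X_exchange(1) by blast
  moreover have "Z = (\<lambda>k. rep (X k))" if "exchange_seq Z" for Z
  proof
    fix k
    have "tor (Z k) = X k"
      using exchange_unique[of "\<lambda>k. tor (Z k)"] that unfolding exchange_seq_iff by blast
    then show "Z k = rep (X k)" using tor_inverse[of "Z k"] by simp
  qed
  ultimately have "clusterX = (\<lambda>k. rep (X k))"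
    unfolding clusterX_def exchange_seq_def[symmetric] by (rule the_equality)
  from fun_cong[OF this, of k] show ?thesis by (simp only: rep_inverse)
qed

section \<open>Supports and leading exponents\<close>

definition supp :: "qtorus \<Rightarrow> (int \<times> int \<times> int) set" where
  "supp x = Poly_Mapping.keys (rep x)"

lemma supp_eq_empty: "supp x = {} \<longleftrightarrow> x = 0"
  by (simp add: supp_def zero_qtorus.rep_eq[symmetric] rep_inject)

lemma supp_0 [simp]: "supp 0 = {}"
  by (simp add: supp_eq_empty)

lemma supp_add: "supp (x + y) \<subseteq> supp x \<union> supp y"
  unfolding supp_def plus_qtorus.rep_eq by (rule keys_add)

lemma supp_diff: "supp (x - y) \<subseteq> supp x \<union> supp y"
  unfolding supp_def minus_qtorus.rep_eq by (rule keys_diff)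

lemma supp_sum: "supp (sum f I) \<subseteq> (\<Union>i\<in>I. supp (f i))"
  by (induction I rule: infinite_finite_induct) (use supp_add in \<open>auto simp: subset_iff, blast\<close>)

lemma supp_mon: "supp (mon r a b) = {(r, a, b)}"
  by (simp add: supp_def mon_def tor_inverse qmon_def)

lemma supp_mult:
  assumes "m \<in> supp (x * y)"
  obtains k l where "k \<in> supp x" "l \<in> supp y" "m = key_mul k l"
  using assms keys_qmul unfolding supp_def times_qtorus.rep_eq by metis

lemma supp_bar: "supp (bar x) \<subseteq> bar_key ` supp x"
proof
  fix k assume "k \<in> supp (bar x)"
  then have "k \<in> Poly_Mapping.keys (frag_extend (\<lambda>k. frag_of (bar_key k)) (rep x))"
    by (simp add: supp_def bar_def key_map_def tor_inverse)
  from subsetD[OF keys_frag_extend this] show "k \<in> bar_key ` supp x"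
    by (auto simp: supp_def)
qed

text \<open>Powers of v are ignored in this comparison, so that multiplication by scalars does not
  affect it.\<close>

definition above :: "int \<Rightarrow> int \<Rightarrow> qtorus set" where
  "above a b = {x. \<forall>(r, c, d)\<in>supp x. a < c \<or> a = c \<and> b < d}"

definition atleast :: "int \<Rightarrow> int \<Rightarrow> qtorus set" where
  "atleast a b = {x. \<forall>(r, c, d)\<in>supp x. a < c \<or> a = c \<and> b \<le> d}"

lemma above_add: "x \<in> above a b \<Longrightarrow> y \<in> above a b \<Longrightarrow> x + y \<in> above a b"
  unfolding above_def using supp_add[of x y] by blast

lemma above_diff: "x \<in> above a b \<Longrightarrow> y \<in> above a b \<Longrightarrow> x - y \<in> above a b"
  unfolding above_def using supp_diff[of x y] by blast

lemma above_sum: "(\<And>i. i \<in> I \<Longrightarrow> f i \<in> above a b) \<Longrightarrow> sum f I \<in> above a b"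
  unfolding above_def using supp_sum[of f I] by blast

lemma atleast_add: "x \<in> atleast a b \<Longrightarrow> y \<in> atleast a b \<Longrightarrow> x + y \<in> atleast a b"
  unfolding atleast_def using supp_add[of x y] by blast

lemma above_atleast: "x \<in> above a b \<Longrightarrow> x \<in> atleast a b"
  unfolding above_def atleast_def by fastforce

lemma atleast_above:
  "x \<in> atleast c d \<Longrightarrow> a < c \<or> a = c \<and> b < d \<Longrightarrow> x \<in> above a b"
  unfolding above_def atleast_def by fastforce

lemma mon_atleast: "mon r a b \<in> atleast a b"
  by (simp add: atleast_def supp_mon)

lemma above_mult_left: "x \<in> above a b \<Longrightarrow> y \<in> atleast c d \<Longrightarrow> x * y \<in> above (a + c) (b + d)"
  unfolding above_def atleast_def by (fastforce elim!: supp_mult)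

lemma above_mult_right: "x \<in> atleast a b \<Longrightarrow> y \<in> above c d \<Longrightarrow> x * y \<in> above (a + c) (b + d)"
  unfolding above_def atleast_def by (fastforce elim!: supp_mult)

lemma atleast_mult: "x \<in> atleast a b \<Longrightarrow> y \<in> atleast c d \<Longrightarrow> x * y \<in> atleast (a + c) (b + d)"
  unfolding atleast_def by (fastforce elim!: supp_mult)

lemma above_bar: "x \<in> above a b \<Longrightarrow> bar x \<in> above a b"
  unfolding above_def using supp_bar[of x] by fastforce

definition pointed :: "int \<Rightarrow> int \<Rightarrow> int \<Rightarrow> qtorus \<Rightarrow> bool" where
  "pointed r a b x \<longleftrightarrow> x - mon r a b \<in> above a b"

lemma pointed_atleast: "pointed r a b x \<Longrightarrow> x \<in> atleast a b"
  using atleast_add[OF above_atleast mon_atleast, of "x - mon r a b" a b r]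
  by (simp add: pointed_def)

lemma pointed_mon: "pointed r a b (mon r a b)"
  by (simp add: pointed_def above_def)

lemma pointed_mult:
  assumes "pointed r a b x" "pointed s c d y"
  shows "pointed (r + s + (a * d - b * c)) (a + c) (b + d) (x * y)"
proof -
  have "x * y - mon r a b * mon s c d = (x - mon r a b) * y + mon r a b * (y - mon s c d)"
    by (simp add: algebra_simps)
  also have "\<dots> \<in> above (a + c) (b + d)"
    using assms pointed_atleast[OF assms(2)] unfolding pointed_def
    by (intro above_add above_mult_left above_mult_right mon_atleast)
  finally show ?thesis by (simp add: pointed_def mon_mult)
qed

lemma pointed_pow: "pointed 0 a b x \<Longrightarrow> pointed 0 (int n * a) (int n * b) (x ^ n)"
proof (induction n)
  case 0 then show ?case using pointed_mon[of 0 0 0] by (simp add: mon_0)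
next
  case (Suc n)
  then show ?case using pointed_mult[of 0 a b x 0 "int n * a" "int n * b" "x ^ n"]
    by (simp add: algebra_simps)
qed

section \<open>Standard monomials of all seeds\<close>

definition stdmon_at :: "int \<Rightarrow> int \<Rightarrow> int \<Rightarrow> qtorus" where
  "stdmon_at m a b = vp (- (a * b)) * X (m + 2) ^ nat (- a) * X m ^ nat a * X (m + 1) ^ nat b
     * X (m - 1) ^ nat (- b)"

lemma tor_stdmon: "tor (stdmon a b) = stdmon_at 1 a b"
  by (simp add: stdmon_def stdmon_at_def tor_simps tor_pow tor_clusterX mon_def pos_part_def max_def)

lemma X_0: "X 0 = mon 0 0 (-1) + mon 0 1 (-1)"
  using X_even[of 0] by (simp add: X_ev_0)

lemma X_3: "X 3 = mon 0 (-1) 0 + mon 0 (-1) 4"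
proof -
  have "mon 0 1 0 * X 3 = vp 4 * mon 0 0 1 ^ 4 + 1"
    using X_exchange(1)[of 2] by (simp add: X_1 X_2 expo_def)
  then have "mon 0 (-1) 0 * (mon 0 1 0 * X 3) = mon 0 (-1) 0 * (vp 4 * mon 0 0 1 ^ 4 + 1)"
    by simp
  then show ?thesis
    by (simp add: mult.assoc[symmetric] mon_mult mon_0 distrib_left power4_eq_xxxx)
qed

lemma pointed_X: "pointed 0 1 0 (X 1)" "pointed 0 0 1 (X 2)" "pointed 0 0 (-1) (X 0)"
  "pointed 0 (-1) 0 (X 3)"
  by (simp_all add: X_1 X_2 pointed_mon) (simp_all add: X_0 X_3 pointed_def above_def supp_mon)

lemma pointed_stdmon_at: "pointed 0 a b (stdmon_at 1 a b)"
proof -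
  note p = pointed_pow[OF pointed_X(1), of "nat a"] pointed_pow[OF pointed_X(2), of "nat b"]
    pointed_pow[OF pointed_X(3), of "nat (- b)"] pointed_pow[OF pointed_X(4), of "nat (- a)"]
  show ?thesis
    using pointed_mult[OF pointed_mult[OF pointed_mult[OF pointed_mult[OF
        pointed_mon[of "- (a * b)" 0 0] p(4)] p(1)] p(2)] p(3)]
    by (cases "a \<ge> 0"; cases "b \<ge> 0") (simp_all add: stdmon_at_def)
qed

section \<open>The module spanned by the standard monomials\<close>

definition neg_scal :: "qtorus set" where
  "neg_scal = {c. \<forall>(r, a, b)\<in>supp c. r < 0 \<and> a = 0 \<and> b = 0}"

lemma neg_scal_iff: "tor c \<in> neg_scal \<longleftrightarrow> c \<in> neg_scalars"
  by (simp add: neg_scal_def neg_scalars_def supp_def tor_inverse)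

lemma neg_scal_0: "0 \<in> neg_scal" by (simp add: neg_scal_def)

lemma neg_scal_diff: "x \<in> neg_scal \<Longrightarrow> y \<in> neg_scal \<Longrightarrow> x - y \<in> neg_scal"
  unfolding neg_scal_def using supp_diff[of x y] by blast

lemma neg_scal_vp: "k < 0 \<Longrightarrow> vp k \<in> neg_scal"
  by (simp add: neg_scal_def supp_mon)

lemma neg_scal_vp_mult: "x \<in> neg_scal \<Longrightarrow> k \<le> 0 \<Longrightarrow> vp k * x \<in> neg_scal"
  unfolding neg_scal_def by (fastforce elim!: supp_mult simp: supp_mon)

lemma neg_scal_atleast: "c \<in> neg_scal \<Longrightarrow> c \<in> atleast 0 0"
  unfolding neg_scal_def atleast_def by fastforce

lemma neg_scal_induct [consumes 1, case_names zero vp diff]: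
  assumes "c \<in> neg_scal" "Q 0" "\<And>k. k < 0 \<Longrightarrow> Q (vp k)" "\<And>x y. Q x \<Longrightarrow> Q y \<Longrightarrow> Q (x - y)"
  shows "Q c"
proof -
  have "Q (tor f)" if "Poly_Mapping.keys f \<subseteq> {(r, a, b). r < 0 \<and> a = 0 \<and> b = 0}" for f
    using that
  proof (induction f rule: frag_induction)
    case (one k)
    then show ?case using assms(3) by (cases k) (auto simp: mon_def qmon_def)
  qed (use assms in \<open>auto simp: tor_simps\<close>)
  moreover have "Poly_Mapping.keys (rep c) \<subseteq> {(r, a, b). r < 0 \<and> a = 0 \<and> b = 0}"
    using assms(1) unfolding neg_scal_def supp_def by blast
  ultimately have "Q (tor (rep c))" by blast
  then show ?thesis by (simp add: rep_inverse)
qed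

lemma neg_scal_central: "c \<in> neg_scal \<Longrightarrow> x * c = c * x"
  by (induction c rule: neg_scal_induct) (simp_all add: vp_central algebra_simps)

lemma neg_scal_bar: "c \<in> neg_scal \<Longrightarrow> bar c = c \<Longrightarrow> c = 0"
proof -
  assume c: "c \<in> neg_scal" "bar c = c"
  have False if k: "k \<in> supp c" for k
  proof -
    obtain k' where k': "k' \<in> supp c" "k = bar_key k'"
      using k supp_bar[of c] unfolding c(2) by blast
    have neg: "fst l < 0" if "l \<in> supp c" for l using that c(1) unfolding neg_scal_def by auto
    have "fst k = - fst k'" unfolding k'(2) by (cases k') simp
    then show False using neg[OF k] neg[OF k'(1)] by simp
  qed
  then show ?thesis using supp_eq_empty by blast
qed

definition scalars :: "qtorus set" where
  "scalars = {c. \<forall>k\<in>supp c. snd k = (0, 0)}"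

lemma neg_scal_scalars: "c \<in> neg_scal \<Longrightarrow> c \<in> scalars"
  by (auto simp: neg_scal_def scalars_def)

lemma scalars_bar: "c \<in> scalars \<Longrightarrow> bar c \<in> scalars"
  using supp_bar[of c] by (fastforce simp: scalars_def)

lemma scalars_diff: "c \<in> scalars \<Longrightarrow> d \<in> scalars \<Longrightarrow> c - d \<in> scalars"
  using supp_diff[of c d] by (auto simp: scalars_def)

lemma scalar_mon_above:
  assumes c: "c \<in> scalars" and above: "c * mon 0 a b \<in> above a b"
  shows "c = 0"
proof -
  have False if k: "k \<in> supp (c * mon 0 a b)" for k
  proof -
    obtain k1 l where "k1 \<in> supp c" "l \<in> supp (mon 0 a b)" "k = key_mul k1 l"
      using k by (rule supp_mult)
    moreover from this have "k1 = (fst k1, 0, 0)" using c by (cases k1) (auto simp: scalars_def)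
    ultimately have "k = (fst k1, a, b)" by (metis supp_mon singletonD key_mul.simps add_0
      add.right_neutral mult_zero_left diff_self)
    then show False using k above unfolding above_def by auto
  qed
  then have "c * mon 0 a b = 0" using supp_eq_empty by blast
  then show ?thesis using mon_nonzero by simp
qed

definition Pmod :: "qtorus set" where "Pmod = tor ` qinv_Aplus"

lemma tor_in_Pmod: "tor x \<in> Pmod \<longleftrightarrow> x \<in> qinv_Aplus"
  by (auto simp: Pmod_def tor_eq_iff)

lemma Pmod_iff: "y \<in> Pmod \<longleftrightarrow> (\<exists>F c. finite F \<and> (\<forall>p\<in>F. c p \<in> neg_scal) \<and> y = (\<Sum>p\<in>F. c p * stdmon_at 1 (fst p) (snd p)))"
proof
  assume "y \<in> Pmod"
  then obtain F c where "finite F" "\<forall>p\<in>F. c p \<in> neg_scalars"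
    "y = tor (\<Sum>p\<in>F. c p \<star> stdmon (fst p) (snd p))"
    by (auto simp: Pmod_def qinv_Aplus_def)
  then show "\<exists>F c. finite F \<and> (\<forall>p\<in>F. c p \<in> neg_scal) \<and> y = (\<Sum>p\<in>F. c p * stdmon_at 1 (fst p) (snd p))"
    by (intro exI[of _ F] exI[of _ "\<lambda>p. tor (c p)"]) (simp add: neg_scal_iff tor_sum tor_simps tor_stdmon)
next
  assume "\<exists>F c. finite F \<and> (\<forall>p\<in>F. c p \<in> neg_scal) \<and> y = (\<Sum>p\<in>F. c p * stdmon_at 1 (fst p) (snd p))"
  then obtain F c where F: "finite F" "\<forall>p\<in>F. c p \<in> neg_scal" "y = (\<Sum>p\<in>F. c p * stdmon_at 1 (fst p) (snd p))"
    by blast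
  have y: "y = tor (\<Sum>p\<in>F. rep (c p) \<star> stdmon (fst p) (snd p))"
    by (simp add: F tor_sum tor_simps tor_stdmon rep_inverse)
  have "\<forall>p\<in>F. rep (c p) \<in> neg_scalars"
    using F(2) by (simp add: neg_scal_iff[symmetric] rep_inverse)
  then have "(\<Sum>p\<in>F. rep (c p) \<star> stdmon (fst p) (snd p)) \<in> qinv_Aplus"
    using F(1) unfolding qinv_Aplus_def by (intro CollectI exI[of _ F] exI[of _ "\<lambda>p. rep (c p)"]) simp
  then show "y \<in> Pmod" using y unfolding Pmod_def by simp
qed

lemma Pmod_E:
  assumes "y \<in> Pmod"
  obtains F c where "finite F" "\<forall>p\<in>F. c p \<in> neg_scal" "y = (\<Sum>p\<in>F. c p * stdmon_at 1 (fst p) (snd p))"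
  using assms[unfolded Pmod_iff] by (elim exE conjE)

lemma neg_scal_stdmon_at_in_Pmod: "c \<in> neg_scal \<Longrightarrow> c * stdmon_at 1 a b \<in> Pmod"
  unfolding Pmod_iff by (rule exI[of _ "{(a, b)}"], rule exI[of _ "\<lambda>_. c"]) simp

interpretation PM: qinv_module vp Pmod
proof
  show "0 \<in> Pmod" unfolding Pmod_iff by (rule exI[of _ "{}"]) simp
next
  fix x y assume "x \<in> Pmod" "y \<in> Pmod"
  obtain F c where F: "finite F" "\<forall>p\<in>F. c p \<in> neg_scal" "x = (\<Sum>p\<in>F. c p * stdmon_at 1 (fst p) (snd p))"
    using \<open>x \<in> Pmod\<close> by (rule Pmod_E)
  obtain G d where G: "finite G" "\<forall>p\<in>G. d p \<in> neg_scal" "y = (\<Sum>p\<in>G. d p * stdmon_at 1 (fst p) (snd p))"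
    using \<open>y \<in> Pmod\<close> by (rule Pmod_E)
  define c' where "c' p = (if p \<in> F then c p else 0)" for p
  define d' where "d' p = (if p \<in> G then d p else 0)" for p
  have "x = (\<Sum>p\<in>F \<union> G. c' p * stdmon_at 1 (fst p) (snd p))"
    unfolding F(3) by (rule sum.mono_neutral_cong_left) (use F G in \<open>auto simp: c'_def\<close>)
  moreover have "y = (\<Sum>p\<in>F \<union> G. d' p * stdmon_at 1 (fst p) (snd p))"
    unfolding G(3) by (rule sum.mono_neutral_cong_left) (use F G in \<open>auto simp: d'_def\<close>)
  ultimately have "x - y = (\<Sum>p\<in>F \<union> G. (c' p - d' p) * stdmon_at 1 (fst p) (snd p))"
    by (simp add: sum_subtractf left_diff_distrib)
  moreover have "c' p \<in> neg_scal" "d' p \<in> neg_scal" for p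
    using F(2) G(2) by (simp_all add: c'_def d'_def neg_scal_0)
  ultimately show "x - y \<in> Pmod"
    unfolding Pmod_iff using F(1) G(1) by (intro exI[of _ "F \<union> G"] exI[of _ "\<lambda>p. c' p - d' p"]) (simp add: neg_scal_diff)
next
  fix x :: qtorus and k :: int assume "x \<in> Pmod" "0 \<le> k"
  obtain F c where F: "finite F" "\<forall>p\<in>F. c p \<in> neg_scal" "x = (\<Sum>p\<in>F. c p * stdmon_at 1 (fst p) (snd p))"
    using \<open>x \<in> Pmod\<close> by (rule Pmod_E)
  have "vp (- k) * x = (\<Sum>p\<in>F. vp (- k) * c p * stdmon_at 1 (fst p) (snd p))"
    by (simp add: F(3) sum_distrib_left mult.assoc)
  then show "vp (- k) * x \<in> Pmod"
    unfolding Pmod_iff using F \<open>0 \<le> k\<close>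
    by (intro exI[of _ F] exI[of _ "\<lambda>p. vp (- k) * c p"]) (simp add: neg_scal_vp_mult)
qed

lemma neg_scal_lat: "c \<in> neg_scal \<Longrightarrow> PM.lat x \<Longrightarrow> c * x \<in> Pmod"
proof (induction c rule: neg_scal_induct)
  case (vp k)
  then show ?case using PM.latD[of x k] by simp
qed (simp_all add: left_diff_distrib PM.P_diff)

text \<open>Among the exponents p occurring with nonzero coefficient, a lexicographically minimal one
  cannot be cancelled, because the standard monomial of index p is pointed at p.\<close>

lemma Pmod_leading:
  assumes "finite F" "\<forall>p\<in>F. c p \<in> neg_scal" "y = (\<Sum>p\<in>F. c p * stdmon_at 1 (fst p) (snd p))"
    and "p' \<in> F" "c p' \<noteq> 0"
  obtains a b where "(a, b) \<in> F" "c (a, b) \<noteq> 0" "y - c (a, b) * mon 0 a b \<in> above a b"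
    "a \<le> fst p'"
proof -
  let ?G = "{p \<in> F. c p \<noteq> 0}"
  define a where "a = Min (fst ` ?G)"
  have G: "finite (fst ` ?G)" "fst ` ?G \<noteq> {}" using assms(1,4,5) by (simp, blast)
  have a: "a \<in> fst ` ?G" "\<And>p. p \<in> ?G \<Longrightarrow> a \<le> fst p"
    unfolding a_def using Min_in[OF G] Min_le[OF G(1)] by auto
  let ?H = "{p \<in> ?G. fst p = a}"
  define b where "b = Min (snd ` ?H)"
  have H: "finite (snd ` ?H)" "snd ` ?H \<noteq> {}" using assms(1) a(1) by (simp, blast)
  have b: "b \<in> snd ` ?H" "\<And>p. p \<in> ?H \<Longrightarrow> b \<le> snd p"
    unfolding b_def using Min_in[OF H] Min_le[OF H(1)] by auto
  have ab: "(a, b) \<in> ?G" using b(1) by auto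
  have "y - c (a, b) * mon 0 a b
     = c (a, b) * (stdmon_at 1 a b - mon 0 a b) + (\<Sum>p\<in>F - {(a, b)}. c p * stdmon_at 1 (fst p) (snd p))"
    using ab assms(1) unfolding assms(3) by (simp add: sum.remove[of F "(a, b)"] right_diff_distrib)
  also have "\<dots> \<in> above a b"
  proof (intro above_add above_sum)
    have "c (a, b) \<in> atleast 0 0" using ab assms(2) neg_scal_atleast by blast
    from above_mult_right[OF this, of "stdmon_at 1 a b - mon 0 a b" a b]
    show "c (a, b) * (stdmon_at 1 a b - mon 0 a b) \<in> above a b"
      using pointed_stdmon_at[of a b] by (simp add: pointed_def)
  next
    fix p assume p: "p \<in> F - {(a, b)}"
    show "c p * stdmon_at 1 (fst p) (snd p) \<in> above a b"
    proof (cases "c p = 0")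
      case True then show ?thesis by (simp add: above_def)
    next
      case False
      have "c p * stdmon_at 1 (fst p) (snd p) \<in> atleast (0 + fst p) (0 + snd p)"
        using p assms(2) by (intro atleast_mult neg_scal_atleast pointed_atleast[OF pointed_stdmon_at]) auto
      moreover have "a < fst p \<or> a = fst p \<and> b < snd p"
        using a(2)[of p] b(2)[of p] p False by (cases p) force
      ultimately show ?thesis using atleast_above by simp
    qed
  qed
  finally show ?thesis using that ab a(2)[of p'] assms(4,5) by auto
qed

text \<open>The coefficient at the lowest exponent is determined by y, so it inherits bar
  invariance; but bar makes its negative powers of v positive, so it would have to vanish.\<close>

lemma Pmod_bar_invariant:
  assumes "y \<in> Pmod" "bar y = y"
  shows "y = 0"
proof (rule ccontr)
  assume "y \<noteq> 0"
  obtain F c where F: "finite F" "\<forall>p\<in>F. c p \<in> neg_scal" "y = (\<Sum>p\<in>F. c p * stdmon_at 1 (fst p) (snd p))"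
    using assms(1) by (rule Pmod_E)
  have "\<exists>p'\<in>F. c p' \<noteq> 0"
    using \<open>y \<noteq> 0\<close> unfolding F(3) by (metis (no_types, lifting) mult_zero_left sum.neutral)
  then obtain a b where ab: "(a, b) \<in> F" "c (a, b) \<noteq> 0" "y - c (a, b) * mon 0 a b \<in> above a b"
    using Pmod_leading[OF F] by metis
  let ?c = "c (a, b)"
  have c: "?c \<in> neg_scal" using ab F by blast
  have "bar (y - ?c * mon 0 a b) = y - bar ?c * mon 0 a b"
    using neg_scal_central[OF c, of "mon 0 a b"]
    by (metis assms(2) bar_simps(3,4,5) minus_zero)
  then have "y - bar ?c * mon 0 a b \<in> above a b" using above_bar[OF ab(3)] by metis
  from above_diff[OF this ab(3)] have "(?c - bar ?c) * mon 0 a b \<in> above a b"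
    by (simp add: left_diff_distrib)
  then have "?c = bar ?c"
    using scalar_mon_above[OF scalars_diff[OF neg_scal_scalars scalars_bar[OF neg_scal_scalars]]] c by simp
  then show False using neg_scal_bar[OF c] ab(2) by simp
qed

text \<open>An index with first coordinate below N would, by \<open>Pmod_leading\<close>, leave an
  uncancelled term of y below N. This is what permits multiplying an element of P by X_0
  later.\<close>

lemma Pmod_support_bound:
  assumes "finite F" "\<forall>p\<in>F. c p \<in> neg_scal" "y = (\<Sum>p\<in>F. c p * stdmon_at 1 (fst p) (snd p))"
    and y: "\<forall>(r, a, b)\<in>supp y. N \<le> a" and p': "p' \<in> F" "c p' \<noteq> 0"
  shows "N \<le> fst p'"
proof (rule ccontr)
  assume N: "\<not> N \<le> fst p'"
  obtain a b where ab: "(a, b) \<in> F" "c (a, b) \<noteq> 0" "y - c (a, b) * mon 0 a b \<in> above a b"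
    "a \<le> fst p'"
    using Pmod_leading[OF assms(1-3) p'] by metis
  have "y \<in> above a b" using y ab(4) N unfolding above_def by fastforce
  from above_diff[OF this ab(3)] have "c (a, b) * mon 0 a b \<in> above a b" by simp
  then show False using scalar_mon_above[OF neg_scal_scalars] ab(1,2) assms(2) by blast
qed

section \<open>Congruences between standard monomials of adjacent seeds\<close>

lemma X_seed:
  "X (m - 1) * X m = vp 2 * (X m * X (m - 1))" "X m * X (m + 1) = vp 2 * (X (m + 1) * X m)"
  "X (m + 1) * X (m + 2) = vp 2 * (X (m + 2) * X (m + 1))"
  "X (m + 2) * X (m + 3) = vp 2 * (X (m + 3) * X (m + 2))"
  "X (m - 1) * X (m + 1) = vp (int (expo m)) * X m ^ expo m + 1"
  "X (m + 1) * X (m - 1) = vp (- int (expo m)) * X m ^ expo m + 1"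
  "X m * X (m + 2) = vp (int (expo (m + 1))) * X (m + 1) ^ expo (m + 1) + 1"
  "X (m + 2) * X m = vp (- int (expo (m + 1))) * X (m + 1) ^ expo (m + 1) + 1"
  "X (m + 1) * X (m + 3) = vp (int (expo m)) * X (m + 2) ^ expo m + 1"
  "X (m + 3) * X (m + 1) = vp (- int (expo m)) * X (m + 2) ^ expo m + 1"
proof -
  have e: "expo (m + 2) = expo m" by (simp add: expo_def)
  have n: "m - 1 + 1 = m" "m + 1 + 1 = m + 2" "m + 2 + 1 = m + 3" "m + 1 - 1 = m" "m + 2 - 1 = m + 1"
    by simp_all
  note s = X_succ[of "m - 1"] X_succ[of m] X_succ[of "m + 1"] X_succ[of "m + 2"]
  note x = X_exchange[of m] X_exchange[of "m + 1"] X_exchange[of "m + 2"]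
  show "X (m - 1) * X m = vp 2 * (X m * X (m - 1))" "X m * X (m + 1) = vp 2 * (X (m + 1) * X m)"
  "X (m + 1) * X (m + 2) = vp 2 * (X (m + 2) * X (m + 1))"
  "X (m + 2) * X (m + 3) = vp 2 * (X (m + 3) * X (m + 2))"
    using s unfolding n by blast+
  show "X (m - 1) * X (m + 1) = vp (int (expo m)) * X m ^ expo m + 1"
  "X (m + 1) * X (m - 1) = vp (- int (expo m)) * X m ^ expo m + 1"
  "X m * X (m + 2) = vp (int (expo (m + 1))) * X (m + 1) ^ expo (m + 1) + 1"
  "X (m + 2) * X m = vp (- int (expo (m + 1))) * X (m + 1) ^ expo (m + 1) + 1"
  "X (m + 1) * X (m + 3) = vp (int (expo m)) * X (m + 2) ^ expo m + 1"
  "X (m + 3) * X (m + 1) = vp (- int (expo m)) * X (m + 2) ^ expo m + 1"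
    using x unfolding n e by blast+
qed

definition seed_lat :: "int \<Rightarrow> bool" where
  "seed_lat m \<longleftrightarrow> (\<forall>a b. PM.lat (stdmon_at m a b))"

lemma seed_change_forward:
  assumes "seed_lat m"
  shows "seed_change vp Pmod (X (m - 1)) (X m) (X (m + 1)) (X (m + 2)) (X (m + 3)) (expo m) (expo (m + 1))"
proof unfold_locales
  fix a b
  show "vp (- 1) * (vp (- (a * b)) * X (m + 2) ^ nat (- a) * X m ^ nat a * X (m + 1) ^ nat b
    * X (m - 1) ^ nat (- b)) \<in> Pmod"
    using assms PM.latD[of "stdmon_at m a b" "-1"] by (simp add: seed_lat_def stdmon_at_def)
qed (simp_all add: X_seed X_nonzero expo_pos[unfolded One_nat_def])

lemma flip_vp_mult: "flip (vp k * x) = vp k * flip x"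
  by (simp add: flip_simps vp_central)

lemma flip_qcommute:
  assumes "x * y = vp k * (y * x)"
  shows "flip y * flip x = vp k * (flip x * flip y)"
proof -
  have "flip (x * y) = vp k * flip (y * x)" unfolding assms flip_vp_mult ..
  then show ?thesis unfolding flip_simps(5) .
qed

lemma flip_exchange:
  assumes "x * y = vp k * z ^ n + 1"
  shows "flip y * flip x = vp k * flip z ^ n + 1"
proof -
  have "flip (x * y) = vp k * flip z ^ n + 1"
    unfolding assms flip_simps(2,6) flip_vp_mult flip_pow ..
  then show ?thesis unfolding flip_simps(5) .
qed

lemma flip_eq_0: "flip x = 0 \<Longrightarrow> x = 0"
  using flip_flip[of x] by (simp add: flip_simps)

text \<open>\<open>flip\<close> reverses products and fixes v, so the five variables in opposite
  order satisfy the same relations. A separate backward version is needed because the forward one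
  presupposes the lattice property of the lower seed.\<close>

lemma seed_change_backward:
  assumes "seed_lat (m + 1)"
  shows "seed_change vp {x. flip x \<in> Pmod} (flip (X (m + 3))) (flip (X (m + 2))) (flip (X (m + 1)))
     (flip (X m)) (flip (X (m - 1))) (expo m) (expo (m + 1))"
proof unfold_locales
  show "0 \<in> {x. flip x \<in> Pmod}" by (simp add: flip_simps)
  show "x - y \<in> {x. flip x \<in> Pmod}" if "x \<in> {x. flip x \<in> Pmod}" "y \<in> {x. flip x \<in> Pmod}" for x y
    using that by (simp add: flip_simps PM.P_diff)
  show "vp (- k) * x \<in> {x. flip x \<in> Pmod}" if "x \<in> {x. flip x \<in> Pmod}" "0 \<le> k" for x k
    using that by (simp add: flip_vp_mult PM.P_q)
  show "flip (X (m + 1)) \<noteq> 0" using flip_eq_0 X_nonzero by blast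
  fix a b
  have "flip (vp (- 1) * (vp (- (a * b)) * flip (X m) ^ nat (- a) * flip (X (m + 2)) ^ nat a
     * flip (X (m + 1)) ^ nat b * flip (X (m + 3)) ^ nat (- b))) = vp (-1) * stdmon_at (m + 1) b a"
    by (simp add: flip_vp_mult mult.assoc)
       (simp add: flip_simps flip_pow flip_flip stdmon_at_def mult.assoc mult.commute[of a] add.assoc)
  moreover have "vp (-1) * stdmon_at (m + 1) b a \<in> Pmod"
    using assms PM.latD[of "stdmon_at (m + 1) b a" "-1"] by (simp add: seed_lat_def)
  ultimately show "vp (- 1) * (vp (- (a * b)) * flip (X m) ^ nat (- a) * flip (X (m + 2)) ^ nat a
     * flip (X (m + 1)) ^ nat b * flip (X (m + 3)) ^ nat (- b)) \<in> {x. flip x \<in> Pmod}" by simp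
qed (simp_all add: expo_pos[unfolded One_nat_def] flip_qcommute flip_exchange X_seed)

lemma stdmon_at_forward:
  assumes "seed_lat m"
  shows "stdmon_at (m + 1) c d - stdmon_at m (- d - int (expo m) * max (- c) 0) c \<in> Pmod"
proof -
  interpret S: seed_change vp Pmod "X (m - 1)" "X m" "X (m + 1)" "X (m + 2)" "X (m + 3)" "expo m" "expo (m + 1)"
    using assms by (rule seed_change_forward)
  have n: "m + 1 + 2 = m + 3" "m + 1 + 1 = m + 2" "m + 1 - 1 = m" by simp_all
  show ?thesis using S.seed_change_cong[of c d] unfolding S.E_def unfolding stdmon_at_def n .
qed

lemma stdmon_at_backward:
  assumes "seed_lat (m + 1)"
  shows "stdmon_at m d c - stdmon_at (m + 1) c (- d - int (expo m) * max (- c) 0) \<in> Pmod"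
proof -
  interpret S: seed_change vp "{x. flip x \<in> Pmod}" "flip (X (m + 3))" "flip (X (m + 2))" "flip (X (m + 1))"
     "flip (X m)" "flip (X (m - 1))" "expo m" "expo (m + 1)"
    using assms by (rule seed_change_backward)
  have n: "m + 1 + 2 = m + 3" "m + 1 + 1 = m + 2" "m + 1 - 1 = m" by simp_all
  have "flip (S.E a b) = stdmon_at (m + 1) b a" for a b
    unfolding S.E_def stdmon_at_def n
    by (simp add: flip_vp_mult mult.assoc)
       (simp add: flip_simps flip_pow flip_flip mult.assoc mult.commute[of a])
  moreover have "flip (vp (- (c * d)) * flip (X (m - 1)) ^ nat (- c) * flip (X (m + 1)) ^ nat c
      * flip (X m) ^ nat d * flip (X (m + 2)) ^ nat (- d)) = stdmon_at m d c"
    unfolding stdmon_at_def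
    by (simp add: flip_vp_mult mult.assoc)
       (simp add: flip_simps flip_pow flip_flip mult.assoc mult.commute[of c])
  ultimately show ?thesis using S.seed_change_cong[of c d] by (simp add: flip_simps(3))
qed

lemma seed_lat_all: "seed_lat m"
proof (induction m rule: int_induct[of _ 1])
  case base
  show ?case unfolding seed_lat_def
    using neg_scal_stdmon_at_in_Pmod[OF neg_scal_vp[of "-1"]] PM.latI by simp
next
  case (step1 i)
  then show ?case using stdmon_at_forward PM.lat_cong unfolding seed_lat_def by blast
next
  case (step2 i)
  then have "seed_lat (i - 1 + 1)" by simp
  from stdmon_at_backward[OF this] show ?case
    using step2(2) PM.lat_cong unfolding seed_lat_def by (metis diff_add_cancel)
qed

lemma stdmon_at_lat: "PM.lat (stdmon_at m a b)"
  using seed_lat_all by (simp add: seed_lat_def)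

lemmas stdmon_at_step = stdmon_at_forward[OF seed_lat_all]

text \<open>The index at m + 1 is the preimage of (a, b) under the piecewise linear map of
  \<open>stdmon_at_step\<close>.\<close>

lemma stdmon_at_step_inv: "stdmon_at m a b - stdmon_at (m + 1) b (- a - int (expo m) * max (- b) 0) \<in> Pmod"
  using PM.P_cong_sym[OF stdmon_at_step[of m b "- a - int (expo m) * max (- b) 0"]] by simp

lemma stdmon_at_to_initial: "\<exists>a' b'. stdmon_at m a b - stdmon_at 1 a' b' \<in> Pmod"
proof (induction m arbitrary: a b rule: int_induct[of _ 1])
  case base
  show ?case by (intro exI[of _ a] exI[of _ b]) simp
next
  case (step1 i)
  then show ?case using stdmon_at_step[of i a b] PM.P_cong_trans by blast
next
  case (step2 i)
  have "stdmon_at (i - 1) a b - stdmon_at i b (- a - int (expo (i - 1)) * max (- b) 0) \<in> Pmod"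
    using stdmon_at_step_inv[of "i - 1" a b] by simp
  then show ?case using step2 PM.P_cong_trans by blast
qed

section \<open>Cluster monomials\<close>

definition cluster_mon :: "int \<Rightarrow> nat \<Rightarrow> nat \<Rightarrow> qtorus" where
  "cluster_mon m a b = vp (- (int a * int b)) * X m ^ a * X (m + 1) ^ b"

lemma cluster_mon_stdmon_at: "cluster_mon m a b = stdmon_at m (int a) (int b)"
  by (simp add: cluster_mon_def stdmon_at_def)

lemma bar_cluster_mon: "bar (cluster_mon m a b) = cluster_mon m a b"
proof -
  have "bar (cluster_mon m a b) = vp (int a * int b) * (X (m + 1) ^ b * X m ^ a)"
    by (simp add: cluster_mon_def bar_simps bar_pow bar_X vp_central mult.assoc)
  also have "\<dots> = vp (int a * int b + - 2 * int b * int a) * (X m ^ a * X (m + 1) ^ b)"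
    unfolding T.power_qcommute[OF T.qcommute_sym[OF X_succ[of m]], of b a] T.q_merge ..
  also have "\<dots> = cluster_mon m a b"
    by (simp add: cluster_mon_def mult.assoc mult.commute[of "int b"])
  finally show ?thesis .
qed

text \<open>With at most one negative index, the factors that occur lie in one cluster, starting at
  m, m + 1 or m - 1; only a reordering remains.\<close>

lemma stdmon_at_cluster_monomial:
  assumes "a \<ge> 0 \<or> b \<ge> 0"
  shows "\<exists>m' a' b'. cluster_mon m' a' b' = stdmon_at m a b"
proof -
  consider "a \<ge> 0" "b \<ge> 0" | "a < 0" "b \<ge> 0" | "a \<ge> 0" "b < 0" using assms by linarith
  then show ?thesis
  proof cases
    case 1
    then have "cluster_mon m (nat a) (nat b) = stdmon_at m a b" by (simp add: cluster_mon_stdmon_at)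
    then show ?thesis by blast
  next
    case 2
    have "X (m + 1) ^ nat b * X (m + 2) ^ nat (- a)
        = vp (2 * b * - a) * (X (m + 2) ^ nat (- a) * X (m + 1) ^ nat b)"
      using T.power_qcommute[OF X_seed(3)[of m], of "nat b" "nat (- a)"] 2 by simp
    then have "cluster_mon (m + 1) (nat b) (nat (- a)) = stdmon_at m a b"
      using 2 by (simp add: cluster_mon_def stdmon_at_def mult.assoc T.q_merge algebra_simps)
    then show ?thesis by blast
  next
    case 3
    have "X (m - 1) ^ nat (- b) * X m ^ nat a
        = vp (2 * - b * a) * (X m ^ nat a * X (m - 1) ^ nat (- b))"
      using T.power_qcommute[OF X_seed(1)[of m], of "nat (- b)" "nat a"] 3 by simp
    then have "cluster_mon (m - 1) (nat (- b)) (nat a) = stdmon_at m a b"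
      using 3 by (simp add: cluster_mon_def stdmon_at_def mult.assoc T.q_merge algebra_simps)
    then show ?thesis by blast
  qed
qed

text \<open>Passing to the seed two steps further replaces (a, b) by (b - a, 3b - 4a), which preserves
  2a - b and strictly decreases b as long as 2a > b.\<close>

lemma third_quadrant_forward:
  assumes "odd m" "a \<ge> 0" "b \<ge> 0" "2 * a > b"
  shows "\<exists>m' a' b'. cluster_mon m' a' b' - stdmon_at m (- a) (- b) \<in> Pmod"
  using assms
proof (induction "nat b" arbitrary: m a b rule: less_induct)
  case less
  have e: "int (expo m) = 1" "int (expo (m + 1)) = 4" using less.prems by (simp_all add: expo_def)
  have "stdmon_at m (- a) (- b) - stdmon_at (m + 1) (- b) (a - b) \<in> Pmod"
    using stdmon_at_step_inv[of m "- a" "- b"] less.prems by (simp add: e)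
  moreover have "stdmon_at (m + 1) (- b) (a - b) - stdmon_at (m + 2) (a - b) (b - 4 * max (b - a) 0) \<in> Pmod"
    using stdmon_at_step_inv[of "m + 1" "- b" "a - b"] unfolding e add.assoc[of m] by simp
  ultimately have cong: "stdmon_at (m + 2) (a - b) (b - 4 * max (b - a) 0) - stdmon_at m (- a) (- b) \<in> Pmod"
    using PM.P_cong_trans PM.P_cong_sym by blast
  show ?case
  proof (cases "a \<ge> b \<or> 4 * a \<ge> 3 * b")
    case True
    then have "a - b \<ge> 0 \<or> b - 4 * max (b - a) 0 \<ge> 0"
      using less.prems by (cases "b \<le> a") auto
    then obtain m' a' b' where "cluster_mon m' a' b' = stdmon_at (m + 2) (a - b) (b - 4 * max (b - a) 0)"
      using stdmon_at_cluster_monomial by blast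
    then show ?thesis using cong by metis
  next
    case False
    have eq: "a - b = - (b - a)" "b - 4 * max (b - a) 0 = - (3 * b - 4 * a)" using False by auto
    obtain m' a' b' where "cluster_mon m' a' b' - stdmon_at (m + 2) (- (b - a)) (- (3 * b - 4 * a)) \<in> Pmod"
      using less.hyps[of "3 * b - 4 * a" "m + 2" "b - a"] less.prems False by auto
    then show ?thesis using cong PM.P_cong_trans unfolding eq by blast
  qed
qed

text \<open>Two steps down replace (a, b) by (3a - b, 4a - b), the inverse of the map used for the
  forward direction. It too preserves 2a - b, and it decreases a as long as 2a < b.\<close>

lemma third_quadrant_backward:
  assumes "odd m" "a \<ge> 0" "b \<ge> 0" "2 * a < b"
  shows "\<exists>m' a' b'. cluster_mon m' a' b' - stdmon_at m (- a) (- b) \<in> Pmod"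
  using assms
proof (induction "nat a" arbitrary: m a b rule: less_induct)
  case less
  have e: "int (expo (m - 1)) = 4" "int (expo (m - 2)) = 1" using less.prems by (simp_all add: expo_def)
  have c1: "stdmon_at m (- a) (- b) - stdmon_at (m - 1) (b - 4 * a) (- a) \<in> Pmod"
    using stdmon_at_step[of "m - 1" "- a" "- b"] less.prems by (simp add: e)
  show ?case
  proof (cases "b \<ge> 4 * a")
    case True
    then obtain m' a' b' where "cluster_mon m' a' b' = stdmon_at (m - 1) (b - 4 * a) (- a)"
      using stdmon_at_cluster_monomial[of "b - 4 * a" "- a" "m - 1"] by auto
    then show ?thesis using PM.P_cong_sym[OF c1] by metis
  next
    case False
    then have "stdmon_at (m - 1) (b - 4 * a) (- a) - stdmon_at (m - 2) (b - 3 * a) (b - 4 * a) \<in> Pmod"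
      using stdmon_at_step[of "m - 2" "b - 4 * a" "- a"] by (simp add: e)
    then have c2: "stdmon_at (m - 2) (b - 3 * a) (b - 4 * a) - stdmon_at m (- a) (- b) \<in> Pmod"
      using c1 PM.P_cong_trans PM.P_cong_sym by blast
    show ?thesis
    proof (cases "b \<ge> 3 * a")
      case True
      then obtain m' a' b' where "cluster_mon m' a' b' = stdmon_at (m - 2) (b - 3 * a) (b - 4 * a)"
        using stdmon_at_cluster_monomial[of "b - 3 * a" "b - 4 * a" "m - 2"] by auto
      then show ?thesis using c2 by metis
    next
      case False': False
      have eq: "b - 3 * a = - (3 * a - b)" "b - 4 * a = - (4 * a - b)" by auto
      obtain m' a' b' where "cluster_mon m' a' b' - stdmon_at (m - 2) (- (3 * a - b)) (- (4 * a - b)) \<in> Pmod"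
        using less.hyps[of "3 * a - b" "m - 2" "4 * a - b"] less.prems False False' by auto
      then show ?thesis using c2 PM.P_cong_trans unfolding eq by blast
    qed
  qed
qed

section \<open>Chebyshev polynomials of X-delta\<close>

definition cheb_delta :: "nat \<Rightarrow> qtorus" where "cheb_delta n = tor (cheb n Xdelta)"

lemma cheb_delta_simps: "cheb_delta 0 = 1" "cheb_delta (Suc 0) = Xd" "cheb_delta (Suc (Suc n)) = cheb_delta (Suc n) * Xd - cheb_delta n"
  by (simp_all add: cheb_delta_def tor_simps Xd_def)

lemma cheb_delta_Xd: "cheb_delta n * Xd = Xd * cheb_delta n"
proof (induction n rule: induct_nat_012)
  case (ge2 n)
  have "cheb_delta (Suc n) * Xd * Xd = Xd * (cheb_delta (Suc n) * Xd)" using ge2(2) by (simp add: mult.assoc)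
  then show ?case using ge2 by (simp add: cheb_delta_simps left_diff_distrib right_diff_distrib)
qed (simp_all add: cheb_delta_simps)

lemma bar_cheb_delta: "bar (cheb_delta n) = cheb_delta n"
  by (induction n rule: induct_nat_012)
     (simp_all add: cheb_delta_simps bar_simps bar_Xd cheb_delta_Xd)

text \<open>The base point j is kept free because the correction subtracted in \<open>xdiff\<close>
  starts one step later.\<close>

definition xprod :: "int \<Rightarrow> int \<Rightarrow> qtorus" where
  "xprod n j = vp (- n) * (X_ev (n + 1 + j) * X_ev j)"

lemma xprod_recursion:
  "Xd * xprod n j = xprod (n + 1) j + xprod (n - 1) j"
proof -
  have n: "n + 1 + j - 1 = n - 1 + 1 + j" "n + 1 + j + 1 = n + 1 + 1 + j" by simp_all
  have "Xd * xprod n j = vp (- n) * (Xd * X_ev (n + 1 + j) * X_ev j)"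
    by (simp add: xprod_def T.q_left[of Xd] mult.assoc)
  then show ?thesis
    unfolding Xd_X_ev n by (simp add: xprod_def distrib_left distrib_right T.q_merge mult.assoc)
qed

text \<open>The factor v^-4 is the one that cancels X_(2j+2)^2 at n = 1, leaving exactly
  X_delta.\<close>

definition xdiff :: "int \<Rightarrow> int \<Rightarrow> qtorus" where
  "xdiff n j = xprod n j - vp (-4) * xprod (n - 2) (j + 1)"

lemma xdiff_recursion: "xdiff (n + 1) j = Xd * xdiff n j - xdiff (n - 1) j"
proof -
  have n: "n + 1 - 2 = n - 2 + 1" "n - 1 - 2 = n - 2 - 1" by simp_all
  show ?thesis
    unfolding xdiff_def right_diff_distrib T.q_left[of Xd] xprod_recursion n
    by (simp add: distrib_left)
qed

lemma xdiff_0: "xdiff 0 j = 1 - vp (-2)"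
  by (simp add: xdiff_def xprod_def T.q_merge add.commute[of 1 j])
     (simp add: X_ev_X_ev_up X_ev_X_ev_down distrib_left T.q_merge)

lemma xdiff_1: "xdiff 1 j = Xd"
  using X_ev_succ_pred[of "j + 1"]
  by (simp add: xdiff_def xprod_def T.q_merge add.commute[of _ j])
     (simp add: distrib_left T.q_merge mon_0)

text \<open>\<open>xdiff\<close> obeys the Chebyshev recursion with initial values 1 - v^-2 and
  X_delta. These are the values of S_n + v^-2 S_(n-2) at n = 0 and 1 once the recursion is run back
  to S_(-1) = 0 and S_(-2) = -1.\<close>

lemma xdiff_cheb_delta: "xdiff (int (Suc (Suc n))) j = cheb_delta (Suc (Suc n)) + vp (-2) * cheb_delta n"
proof -
  have rec: "xdiff (int (Suc (Suc k))) j = Xd * xdiff (int (Suc k)) j - xdiff (int k) j" for k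
    using xdiff_recursion[of "int (Suc k)" j] by (simp add: add.commute)
  have 2: "xdiff (int (Suc (Suc 0))) j = cheb_delta (Suc (Suc 0)) + vp (-2) * cheb_delta 0"
    using rec[of 0] by (simp add: xdiff_0 xdiff_1 cheb_delta_simps)
  show ?thesis
  proof (induction n rule: induct_nat_012)
    case 0 show ?case by (rule 2)
  next
    case 1
    have "xdiff (int (Suc (Suc (Suc 0)))) j = Xd * (cheb_delta (Suc (Suc 0)) + vp (-2) * cheb_delta 0) - Xd"
      using rec[of "Suc 0"] unfolding 2 by (simp add: xdiff_1)
    then show ?case
      by (simp add: cheb_delta_simps(3)[of "Suc 0"] cheb_delta_Xd distrib_left cheb_delta_simps(1,2) vp_central)
  next
    case (ge2 n)
    show ?case unfolding rec[of "Suc (Suc n)"] ge2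
      by (simp add: cheb_delta_simps(3)[of "Suc (Suc n)"] cheb_delta_simps(3)[of n] cheb_delta_Xd T.q_left[of Xd]
          distrib_left right_diff_distrib del: cheb_delta_simps)
  qed
qed

text \<open>Each step of the recursion multiplies by X_delta, whose X_1-exponents are at least
  -1.\<close>

lemma X_ev_support: "\<forall>(r, a, b)\<in>supp (X_ev (int n + 1)). - int n \<le> a"
proof -
  let ?Q = "\<lambda>N x. \<forall>k\<in>supp x. N \<le> fst (snd k)"
  have Qm: "?Q (M + N) (x * y)" if "?Q M x" "?Q N y" for M N x y
  proof
    fix k assume "k \<in> supp (x * y)"
    then obtain k1 k2 where "k1 \<in> supp x" "k2 \<in> supp y" "k = key_mul k1 k2" by (rule supp_mult)
    then show "M + N \<le> fst (snd k)" using that by (cases k1; cases k2) fastforce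
  qed
  have Qd: "?Q N (x - y)" if "?Q N x" "?Q N y" for N x y
    using that supp_diff[of x y] by blast
  have Qv: "?Q 0 (vp r)" for r by (simp add: supp_mon)
  have Qz: "?Q (-1) Xd"
  proof -
    have "supp Xd \<subseteq> {(0,-1,-2),(0,-1,2),(0,1,-2),(-1,0,-2),(1,0,-2)}"
      unfolding Xd_eq
      by (intro order_trans[OF supp_add] Un_least) (simp_all add: supp_mon)
    then show ?thesis by auto
  qed
  have Q0: "?Q 0 (X_ev 0)"
    unfolding X_ev_0 using supp_add[of "mon 0 0 (-1)" "mon 0 1 (-1)"] by (auto simp: supp_mon)
  have Q1: "?Q 0 (X_ev 1)" by (simp add: X_ev_1 supp_mon)
  have step: "?Q (N - 1) (X_ev (j + 1))" if "?Q N (X_ev j)" "?Q (N - 1) (X_ev (j - 1))" for j N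
  proof -
    have "?Q (N - 1) (vp 1 * (Xd * X_ev j))" "?Q (N - 1) (vp 2 * X_ev (j - 1))"
      using Qm[OF Qv Qm[OF Qz that(1)]] Qm[OF Qv that(2)] by simp_all
    then show ?thesis unfolding X_ev_succ by (rule Qd)
  qed
  have "?Q (- int n) (X_ev (int n + 1)) \<and> ?Q (- int n - 1) (X_ev (int n))"
  proof (induction n)
    case 0
    then show ?case using Q0 Q1 by force
  next
    case (Suc n)
    have "?Q (- int n - 1) (X_ev (int n + 1 + 1))" using step[of "int n + 1" "- int n"] Suc by simp
    then show ?case using Suc by (force simp: add.commute)
  qed
  then show ?thesis by fastforce
qed

text \<open>In its own seed X_(2n+2) has index (1,0). Three steps down give (0,1), (-1,0), (-1,-1),
  and every further double step adds (-1,-2); t = n - 1 arrives at the initial seed.\<close>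

lemma X_ev_cong_stdmon_at_seed: "X_ev (n + 1) - stdmon_at (2 * (n - int t) - 1) (- int t - 1) (- 2 * int t - 1) \<in> Pmod"
proof (induction t)
  case 0
  have o: "int (expo (2 * n + 1)) = 1" "int (expo (2 * n - 1)) = 1" "int (expo (2 * n)) = 4"
    by (simp_all add: expo_def)
  have "X_ev (n + 1) = stdmon_at (2 * n + 2) 1 0"
    using X_even[of "n + 1"] by (simp add: stdmon_at_def mon_0 algebra_simps)
  moreover have "stdmon_at (2 * n + 2) 1 0 - stdmon_at (2 * n + 1) 0 1 \<in> Pmod"
    using stdmon_at_step[of "2 * n + 1" 1 0] unfolding o add.assoc[of "2 * n"] by simp
  moreover have "stdmon_at (2 * n + 1) 0 1 - stdmon_at (2 * n) (-1) 0 \<in> Pmod"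
    using stdmon_at_step[of "2 * n" 0 1] by (simp add: o)
  moreover have "stdmon_at (2 * n) (-1) 0 - stdmon_at (2 * n - 1) (-1) (-1) \<in> Pmod"
    using stdmon_at_step[of "2 * n - 1" "-1" 0] by (simp add: o)
  ultimately show ?case using PM.P_cong_trans
    by (metis (no_types, lifting) diff_zero mult_zero_right of_nat_0 minus_zero diff_0)
next
  case (Suc t)
  let ?m = "2 * (n - int t) - 3" and ?t = "int t + 1"
  have o: "int (expo (?m + 1)) = 4" "int (expo ?m) = 1"
    by (simp_all add: expo_def)
  have "stdmon_at (?m + 2) (- ?t) (- (2 * ?t - 1)) - stdmon_at (?m + 1) (- 2 * ?t - 1) (- ?t) \<in> Pmod"
    using stdmon_at_step[of "?m + 1" "- ?t" "- (2 * ?t - 1)"] unfolding o by (simp add: algebra_simps)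
  moreover have "stdmon_at (?m + 1) (- 2 * ?t - 1) (- ?t) - stdmon_at ?m (- ?t - 1) (- 2 * ?t - 1) \<in> Pmod"
    using stdmon_at_step[of ?m "- 2 * ?t - 1" "- ?t"] unfolding o by (simp add: algebra_simps)
  ultimately have "stdmon_at (?m + 2) (- ?t) (- (2 * ?t - 1)) - stdmon_at ?m (- ?t - 1) (- 2 * ?t - 1) \<in> Pmod"
    by (rule PM.P_cong_trans)
  moreover have eqs: "2 * (n - int t) - 1 = ?m + 2" "- int t - 1 = - ?t"
    "- 2 * int t - 1 = - (2 * ?t - 1)" "2 * (n - int (Suc t)) - 1 = ?m"
    "- int (Suc t) - 1 = - ?t - 1" "- 2 * int (Suc t) - 1 = - 2 * ?t - 1"
    by simp_all
  ultimately show ?case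
    using PM.P_cong_trans[OF Suc[unfolded eqs(1-3)]] unfolding eqs(4-6) by blast
qed

lemma X_ev_cong_stdmon_at: "n \<ge> 1 \<Longrightarrow> X_ev (int n + 1) - stdmon_at 1 (- int n) (1 - 2 * int n) \<in> Pmod"
  using X_ev_cong_stdmon_at_seed[of "int n" "n - 1"] by (simp add: of_nat_diff algebra_simps)

interpretation S1: seed_change vp Pmod "X 0" "X 1" "X 2" "X 3" "X 4" 1 4
  using seed_change_forward[OF seed_lat_all[of 1]] by (simp add: expo_def)

text \<open>Lowering the second index by one changes the normalising exponent by a, which leaves the
  factor v^-a.\<close>

lemma stdmon_at_X0: "stdmon_at 1 a b * X 0 = vp (- a) * S1.M (nat (- a)) (nat a) (nat b) (Suc (nat (- b)))"
proof -
  have "stdmon_at 1 a b * X 0 = vp (- (a * b)) * S1.mword (nat (- a)) (nat a) (nat b) (Suc (nat (- b)))"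
    by (simp add: stdmon_at_def S1.mword_def mult.assoc power_Suc2[of "X 0"] del: power_Suc)
  also have "\<dots> = vp (- (a * b) + (int (nat a) - int (nat (- a))) * (int (nat b) - int (Suc (nat (- b)))))
     * S1.M (nat (- a)) (nat a) (nat b) (Suc (nat (- b)))"
    unfolding S1.mword_M T.q_merge ..
  also have "- (a * b) + (int (nat a) - int (nat (- a))) * (int (nat b) - int (Suc (nat (- b)))) = - a"
    by (cases "a \<ge> 0"; cases "b \<ge> 0") (simp_all add: algebra_simps)
  finally show ?thesis .
qed

text \<open>The main term merely gains one factor X_0. The error y stays in P after multiplication
  by v^-n X_0, because its indices have first coordinate at least -n.\<close>

lemma xprod_cong_stdmon_at:
  assumes "n \<ge> 1"
  shows "xprod (int n) 0 - stdmon_at 1 (- int n) (- 2 * int n) \<in> Pmod"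
proof -
  let ?e = "stdmon_at 1 (- int n) (1 - 2 * int n)"
  define y where "y = X_ev (int n + 1) - ?e"
  have "y \<in> Pmod" using X_ev_cong_stdmon_at[OF assms] by (simp add: y_def)
  then obtain F c where F: "finite F" "\<forall>p\<in>F. c p \<in> neg_scal" "y = (\<Sum>p\<in>F. c p * stdmon_at 1 (fst p) (snd p))"
    by (rule Pmod_E)
  have "\<forall>(r, a, b)\<in>supp ?e. - int n \<le> a"
    using pointed_atleast[OF pointed_stdmon_at] unfolding atleast_def by fastforce
  then have supp: "\<forall>(r, a, b)\<in>supp y. - int n \<le> a"
    unfolding y_def using X_ev_support[of n] supp_diff[of "X_ev (int n + 1)" ?e] by blast
  have "vp (- int n) * (y * X 0) = (\<Sum>p\<in>F. vp (- int n - fst p) * c p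
      * S1.M (nat (- fst p)) (nat (fst p)) (nat (snd p)) (Suc (nat (- snd p))))"
    unfolding F(3) sum_distrib_left sum_distrib_right
  proof (rule sum.cong[OF refl])
    fix p assume "p \<in> F"
    have "c p * (vp k * z) = vp k * (c p * z)" for k z by (rule T.q_left)
    then show "vp (- int n) * (c p * stdmon_at 1 (fst p) (snd p) * X 0) = vp (- int n - fst p) * c p
      * S1.M (nat (- fst p)) (nat (fst p)) (nat (snd p)) (Suc (nat (- snd p)))"
      by (simp add: mult.assoc stdmon_at_X0 T.q_merge)
  qed
  also have "\<dots> \<in> Pmod"
  proof (rule PM.P_sum)
    fix p assume p: "p \<in> F"
    show "vp (- int n - fst p) * c p
      * S1.M (nat (- fst p)) (nat (fst p)) (nat (snd p)) (Suc (nat (- snd p))) \<in> Pmod"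
    proof (cases "c p = 0")
      case False
      then have "- int n \<le> fst p" using Pmod_support_bound[OF F supp p] by simp
      then show ?thesis using F(2) p by (intro neg_scal_lat neg_scal_vp_mult S1.M_lat) auto
    qed simp
  qed
  finally have "vp (- int n) * (y * X 0) \<in> Pmod" .
  moreover have "vp (- int n) * (?e * X 0) = stdmon_at 1 (- int n) (- 2 * int n)"
  proof -
    have "nat (2 * int n) = Suc (nat (2 * int n - 1))" using assms by simp
    then have "X 0 ^ nat (2 * int n) = X 0 ^ nat (2 * int n - 1) * X 0" by (simp only: power_Suc2)
    then show ?thesis
      using assms by (simp add: stdmon_at_def T.q_merge mult.assoc algebra_simps)
  qed
  moreover have "xprod (int n) 0 = vp (- int n) * (y * X 0) + vp (- int n) * (?e * X 0)"
    using X_even[of 0] by (simp add: xprod_def y_def left_diff_distrib right_diff_distrib)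
  ultimately show ?thesis by simp
qed

lemma xprod_lat_base: "vp (-4) * xprod (-1) j \<in> Pmod" "vp (-2) * xprod 0 j \<in> Pmod"
proof -
  have "X_ev j * X_ev j = stdmon_at (2 * j) 2 0"
    by (simp add: stdmon_at_def mon_0 X_even power2_eq_square)
  then show "vp (-4) * xprod (-1) j \<in> Pmod"
    using PM.latD[OF stdmon_at_lat, of "-3" "2 * j" 2 0] by (simp add: xprod_def T.q_merge)
  have "X_od j = stdmon_at (2 * j + 1) 1 0" "stdmon_at 1 0 0 = 1"
    by (simp_all add: stdmon_at_def mon_0 X_odd)
  then have "vp (-3) * X_od j \<in> Pmod" "vp (-2) * 1 \<in> Pmod"
    using PM.latD[OF stdmon_at_lat, of "-3" "2 * j + 1" 1 0] PM.latD[OF stdmon_at_lat, of "-2" 1 0 0] by simp_all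
  then show "vp (-2) * xprod 0 j \<in> Pmod"
    using PM.P_add[of "vp (-3) * X_od j" "vp (-2) * 1"]
    by (simp add: xprod_def mon_0 add.commute[of 1 j] X_ev_X_ev_down distrib_left T.q_merge)
qed

text \<open>The congruence for n + 2 discards v^-2 S_n and v^-4 times a product of degree n. The
  second discard is what the companion claim \<open>?B\<close> provides; it ranges over all j since
  that product starts at j + 1.\<close>

lemma cheb_delta_cong_stdmon_at: "cheb_delta n - stdmon_at 1 (- int n) (- 2 * int n) \<in> Pmod"
proof -
  let ?A = "\<lambda>n. cheb_delta n - stdmon_at 1 (- int n) (- 2 * int n) \<in> Pmod"
  let ?B = "\<lambda>n. \<forall>j. vp (-2) * xprod (int n) j \<in> Pmod"
  have "?A n \<and> ?B n"
  proof (induction n rule: induct_nat_012)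
    case 0
    show ?case using xprod_lat_base by (simp add: cheb_delta_simps stdmon_at_def mon_0)
  next
    case 1
    have d: "xprod 1 j = Xd + vp (-4) * xprod (-1) (j + 1)" for j
      using xdiff_1[of j] by (simp add: xdiff_def algebra_simps)
    have A: "?A 1"
      using PM.P_diff[OF xprod_cong_stdmon_at[of 1] xprod_lat_base(1)[of 1]]
      by (simp add: d cheb_delta_simps algebra_simps)
    then have "PM.lat (cheb_delta 1)" using stdmon_at_lat PM.lat_cong by blast
    then have "vp (-2) * Xd \<in> Pmod" using PM.latD by (simp add: cheb_delta_simps)
    then have "?B 1"
      using PM.P_add PM.P_q[OF xprod_lat_base(1), of 2] by (simp add: d distrib_left)
    then show ?case using A by simp
  next
    case (ge2 n)
    let ?N = "Suc (Suc n)"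
    have d: "xprod (int ?N) j = cheb_delta ?N + vp (-2) * cheb_delta n + vp (-4) * xprod (int n) (j + 1)" for j
      using xdiff_cheb_delta[of n j] by (simp add: xdiff_def algebra_simps)
    have lat: "PM.lat (cheb_delta n)" using ge2(1) stdmon_at_lat PM.lat_cong by blast
    have l2: "vp (-2) * cheb_delta n \<in> Pmod" using PM.latD[OF lat] by simp
    have b: "vp (-4) * xprod (int n) (j + 1) \<in> Pmod" for j
      using ge2(1) PM.P_q[of "vp (-2) * xprod (int n) (j + 1)" 2] by (simp add: T.q_merge)
    have "cheb_delta ?N - stdmon_at 1 (- int ?N) (- 2 * int ?N)
      = (xprod (int ?N) 0 - stdmon_at 1 (- int ?N) (- 2 * int ?N)) - (vp (-2) * cheb_delta n + vp (-4) * xprod (int n) (0 + 1))"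
      unfolding d by (simp add: algebra_simps)
    also have "\<dots> \<in> Pmod" by (intro PM.P_diff PM.P_add xprod_cong_stdmon_at l2 b) simp
    finally have A: "?A ?N" .
    then have "PM.lat (cheb_delta ?N)" using stdmon_at_lat PM.lat_cong by blast
    then have "vp (-2) * cheb_delta ?N \<in> Pmod" using PM.latD by simp
    then have "?B ?N"
      unfolding d distrib_left using PM.P_q[OF l2, of 2] PM.P_q[OF b, of 2] by (auto intro!: PM.P_add)
    then show ?case using A by blast
  qed
  then show ?thesis by blast
qed

section \<open>The triangular basis\<close>

lemma Aq14_pow: "f \<in> Aq14 \<Longrightarrow> qpow f n \<in> Aq14"
  using Aq14.scal[of 0] by (induction n) (auto simp: qone_def intro: Aq14.mul)

lemma Aq14_zero: "0 \<in> Aq14"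
  using Aq14.add[OF Aq14.scal[of 0] Aq14.neg[OF Aq14.scal[of 0]]] by simp

lemma Aq14_sum: "(\<And>i. i \<in> I \<Longrightarrow> f i \<in> Aq14) \<Longrightarrow> sum f I \<in> Aq14"
  by (induction I rule: infinite_finite_induct) (auto intro: Aq14.add Aq14_zero)

lemma stdmon_Aq14: "stdmon a b \<in> Aq14"
  unfolding stdmon_def by (intro Aq14.mul Aq14.scal Aq14_pow Aq14.gen)

lemma neg_scalars_Aq14:
  assumes "c \<in> neg_scalars"
  shows "c \<in> Aq14"
proof -
  have "Poly_Mapping.keys c \<subseteq> {(r, a, b). a = 0 \<and> b = 0}"
    using assms by (auto simp: neg_scalars_def)
  then show ?thesis
  proof (induction c rule: frag_induction)
    case (one k)
    then show ?case using Aq14.scal by (cases k) (auto simp: qmon_def)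
  next
    case (diff f g)
    then show ?case using Aq14.add[OF _ Aq14.neg] by (metis diff_conv_add_uminus)
  qed (rule Aq14_zero)
qed

lemma qinv_Aplus_Aq14: "y \<in> qinv_Aplus \<Longrightarrow> y \<in> Aq14"
  unfolding qinv_Aplus_def
  by (elim CollectE exE conjE) (simp, intro Aq14_sum Aq14.mul stdmon_Aq14 neg_scalars_Aq14, blast)

text \<open>Membership in the algebra is automatic, because P and the standard monomials lie in it.
  Two candidates differ by a bar-invariant element of P, hence by 0.\<close>

lemma triangC_eqI:
  assumes "qbar c = c" and P: "tor c - stdmon_at 1 a b \<in> Pmod"
  shows "triangC a b = c"
  unfolding triangC_def
proof (rule the_equality)
  have cE: "c - stdmon a b \<in> qinv_Aplus"
    using P by (simp add: tor_in_Pmod[symmetric] tor_simps tor_stdmon)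
  then have "c \<in> Aq14"
    using Aq14.add[OF qinv_Aplus_Aq14[OF cE] stdmon_Aq14[of a b]] by simp
  then show "c \<in> Aq14 \<and> qbar c = c \<and> c - stdmon a b \<in> qinv_Aplus" using assms(1) cE by blast
next
  fix d assume d: "d \<in> Aq14 \<and> qbar d = d \<and> d - stdmon a b \<in> qinv_Aplus"
  then have "tor d - stdmon_at 1 a b \<in> Pmod"
    by (simp add: tor_in_Pmod[symmetric] tor_simps tor_stdmon)
  from PM.P_diff[OF this P] have "tor d - tor c \<in> Pmod" by simp
  moreover have "bar (tor d - tor c) = tor d - tor c"
    using d assms(1) by (simp add: bar_simps tor_qbar[symmetric])
  ultimately have "tor d - tor c = 0" by (rule Pmod_bar_invariant)
  then show "d = c" by (simp add: tor_eq_iff)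
qed

lemma tor_cluster_monomial:
  "tor (qmon (- (int a * int b)) 0 0 \<star> qpow (clusterX m) a \<star> qpow (clusterX (m + 1)) b) = cluster_mon m a b"
  by (simp add: tor_simps tor_pow tor_clusterX cluster_mon_def mon_def)

lemma qbar_eqI: "bar (tor c) = tor c \<Longrightarrow> qbar c = c"
  by (simp add: tor_qbar[symmetric] tor_eq_iff)

theorem theorem4p12:
  shows "{qmon (- (int a * int b)) 0 0 \<star> qpow (clusterX m) a \<star> qpow (clusterX (m + 1)) b
           | m a b. True} \<union> {cheb n Xdelta | n. n \<ge> 1}
         = {triangC a b | a b. True}"
    (is "?L \<union> ?R = ?C")
proof
  have "\<exists>a' b'. triangC a' b' = qmon (- (int a * int b)) 0 0 \<star> qpow (clusterX m) a \<star> qpow (clusterX (m + 1)) b"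
    for m a b
    using stdmon_at_to_initial[of m "int a" "int b"]
    by (metis triangC_eqI qbar_eqI tor_cluster_monomial bar_cluster_mon cluster_mon_stdmon_at)
  moreover have cheb: "triangC (- int n) (- 2 * int n) = cheb n Xdelta" for n
    using triangC_eqI[OF qbar_eqI, of "cheb n Xdelta"] cheb_delta_cong_stdmon_at[of n] bar_cheb_delta[of n]
    by (simp add: cheb_delta_def)
  ultimately show "?L \<union> ?R \<subseteq> ?C" by (auto; metis)
  show "?C \<subseteq> ?L \<union> ?R"
  proof
    fix x assume "x \<in> ?C"
    then obtain a b where x: "x = triangC a b" by blast
    have mono: "x \<in> ?L" if "cluster_mon m a' b' - stdmon_at 1 a b \<in> Pmod" for m a' b'
      using that triangC_eqI[OF qbar_eqI] unfolding x
      by (metis (mono_tags, lifting) tor_cluster_monomial bar_cluster_mon mem_Collect_eq)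
    consider "a \<ge> 0 \<or> b \<ge> 0" | "a < 0" "b < 0" "2 * a = b" | "a < 0" "b < 0" "2 * a < b"
      | "a < 0" "b < 0" "2 * a > b" by linarith
    then show "x \<in> ?L \<union> ?R"
    proof cases
      case 1
      then obtain m a' b' where "cluster_mon m a' b' = stdmon_at 1 a b" using stdmon_at_cluster_monomial by blast
      then have "cluster_mon m a' b' - stdmon_at 1 a b \<in> Pmod" by simp
      then show ?thesis using mono by (intro UnI1)
    next
      case 2
      then have "x = cheb (nat (- a)) Xdelta" using cheb[of "nat (- a)"] by (simp add: x)
      then show ?thesis using 2 by (intro UnI2 CollectI exI[of _ "nat (- a)"]) simp
    next
      case 3
      then obtain m a' b' where "cluster_mon m a' b' - stdmon_at 1 (- (- a)) (- (- b)) \<in> Pmod"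
        using third_quadrant_forward[of 1 "- a" "- b"] by auto
      then show ?thesis using mono by (intro UnI1) simp
    next
      case 4
      then obtain m a' b' where "cluster_mon m a' b' - stdmon_at 1 (- (- a)) (- (- b)) \<in> Pmod"
        using third_quadrant_backward[of 1 "- a" "- b"] by auto
      then show ?thesis using mono by (intro UnI1) simp
    qed
  qed
qed

end
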